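(* Let $q,h,a,x,y,z$ be non-zero complex numbers with $|q|<1$ and $|q^3a^4|<|xyz|^3$, let $\omega=\mathrm e^{\frac23\pi i}$, $\sigma\in(0,\infty)$, $w=\mathrm e^{i\psi}$. Assume there are no vanishing denominator factors and that the denominator factors in the integrand have maximum modulus less than unity, i.e. $\big|\sigma\sqrt{\frac{xyz}{qa}}\big|$, $\big|\sigma\sqrt{\frac{qa}{xyz}}\big|$, $\big|\sqrt{\frac{qax}{yz}}\big|/\sigma$, $\big|\sqrt{\frac{qay}{xz}}\big|/\sigma$, $\big|\sqrt{\frac{qaz}{xy}}\big|/\sigma$, $\big|a^{5/6}\sqrt{\frac q{xyz}}\big|/\sigma$ are all $<1$. Then $${}_{12}W_{11}\!\left(a;x,qx,q^2x,y,qy,q^2y,z,qz,q^2z;q^3,\frac{q^3a^4}{(xyz)^3}\right)=\frac{(q,qa,\frac{qa}{xy},\frac{qa}{xz},\frac{qa}{yz},x,y,z,a^{1/3},\omega a^{1/3},\omega^2a^{1/3};q)_\infty}{2\pi\,\vartheta(h,h\frac{xyz}{qa};q)\,(\frac{qa}x,\frac{qa}y,\frac{qa}z,a;q)_\infty}$$ $$\times\int_{-\pi}^{\pi}\frac{\left(\big(h\sqrt{\frac{xyz}{qa}},\frac qh\sqrt{\frac{qa}{xyz}}\big)\frac\sigma w,\ \big(h\sqrt{\frac{xyz}{qa}},\frac qh\sqrt{\frac{qa}{xyz}},\pm a\sqrt{\frac q{xyz}},\pm\frac{qa}{\sqrt{xyz}}\big)\frac w\sigma;q\right)_\infty}{\left(\big(\sqrt{\frac{xyz}{qa}},\sqrt{\frac{qa}{xyz}}\big)\frac\sigma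 w,\ \big(\sqrt{\frac{qax}{yz}},\sqrt{\frac{qay}{xz}},\sqrt{\frac{qaz}{xy}},\kappa,\omega\kappa,\omega^2\kappa\big)\frac w\sigma;q\right)_\infty}\,\mathrm d\psi,\qquad \kappa:=a^{5/6}\sqrt{\frac q{xyz}}.$$
   Context: Notation. $(a;q)_k=\prod_{j=0}^{k-1}(1-aq^j)$, $(a;q)_\infty=\prod_{j\ge0}(1-aq^j)$, $(a_1,\dots,a_r;q)_k=\prod_j(a_j;q)_k$ for $k\in\mathbb N_0\cup\{\infty\}$. In a list, $\pm t$ stands for the two entries $t,-t$, and $(t_1,\dots,t_k)s$ stands for the entries $t_1s,\dots,t_ks$. $\vartheta(t;q)=(t,q/t;q)_\infty$ for $t\ne0$, $\vartheta(t_1,\dots,t_k;q)=\prod_j\vartheta(t_j;q)$. ${}_{r+1}\phi_r(a_1,\dots,a_{r+1};b_1,\dots,b_r;p,t)=\sum_{k\ge0}\frac{(a_1,\dots,a_{r+1};p)_k}{(p,b_1,\dots,b_r;p)_k}t^k$ for $|t|<1$. The very-well-poised series in base $p$ is $${}_{12}W_{11}(a;a_4,\dots,a_{12};p,t)={}_{12}\phi_{11}\!\left(a,\pm p\sqrt a,a_4,\dots,a_{12};\pm\sqrt a,\tfrac{pa}{a_4},\dots,\tfrac{pa}{a_{12}};p,t\right),$$ used here with $p=q^3$. Roots are chosen consistently: fix a sixth root $a^{1/6}$ of $a$ (fractional powers of $a$ are powers of it) and square roots of $q,x,y,z$, and define all roots of monomials multiplicatively from these. Convention "no vanishing denominator factors":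 every infinite $q$-shifted factorial and every theta function appearing in a denominator is non-zero, and no denominator parameter of the series makes a denominator factor vanish. *)

theory Defs
  imports "HOL-Analysis.Analysis"
begin

definition qpoch :: "complex \<Rightarrow> complex \<Rightarrow> nat \<Rightarrow> complex" where
  "qpoch a q k = (\<Prod>j<k. 1 - a * q ^ j)"

definition qpoch_inf :: "complex \<Rightarrow> complex \<Rightarrow> complex" where
  "qpoch_inf a q = (\<Prod>j. 1 - a * q ^ j)"

definition qpochs :: "complex list \<Rightarrow> complex \<Rightarrow> nat \<Rightarrow> complex" where
  "qpochs as q k = (\<Prod>a\<leftarrow>as. qpoch a q k)"

definition qpochs_inf :: "complex list \<Rightarrow> complex \<Rightarrow> complex" where
  "qpochs_inf as q = (\<Prod>a\<leftarrow>as. qpoch_inf a q)"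

definition qtheta :: "complex \<Rightarrow> complex \<Rightarrow> complex" where
  "qtheta t q = qpochs_inf [t, q / t] q"

definition qthetas :: "complex list \<Rightarrow> complex \<Rightarrow> complex" where
  "qthetas ts q = (\<Prod>t\<leftarrow>ts. qtheta t q)"

definition q_hypergeom ::
    "complex list \<Rightarrow> complex list \<Rightarrow> complex \<Rightarrow> complex \<Rightarrow> complex" where
  "q_hypergeom as bs p t = (\<Sum>k. qpochs as p k / qpochs (p # bs) p k * t ^ k)"

text \<open>The very-well-poised series with leading parameter \<open>a\<close>. Its parameters involve
  a square root of \<open>a\<close>; the chosen root is passed as the argument \<open>s\<close>, with
  \<open>s\<^sup>2 = a\<close>. The list \<open>cs\<close> contains the parameters from the fourth one on,
  so nine entries give the series with twelve upper and eleven lower parameters.\<close>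

definition vwp_upper :: "complex \<Rightarrow> complex \<Rightarrow> complex list \<Rightarrow> complex \<Rightarrow> complex list" where
  "vwp_upper a s cs p = [a, p * s, - (p * s)] @ cs"

definition vwp_lower :: "complex \<Rightarrow> complex \<Rightarrow> complex list \<Rightarrow> complex \<Rightarrow> complex list" where
  "vwp_lower a s cs p = [s, - s] @ map (\<lambda>c. p * a / c) cs"

definition vwp_series ::
    "complex \<Rightarrow> complex \<Rightarrow> complex list \<Rightarrow> complex \<Rightarrow> complex \<Rightarrow> complex" where
  "vwp_series a s cs p t = q_hypergeom (vwp_upper a s cs p) (vwp_lower a s cs p) p t"

end

theory Submission
  imports Defs "HOL-Complex_Analysis.Complex_Analysis"
begin

text \<open>
  Let \<open>r\<close> be the chosen root of \<open>xyz/(qa)\<close> and \<open>A\<close>, \<open>B\<close>, \<open>C\<close> those of \<open>qax/(yz)\<close>, \<open>qay/(xz)\<close>,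
  \<open>qaz/(xy)\<close>. Then \<open>x = A r\<close> and \<open>q a / x = B C\<close>, and similarly for \<open>y\<close> and \<open>z\<close>, so the part
  \<open>(x,y,z;q)\<^sub>3\<^sub>k / (qa/x,qa/y,qa/z;q)\<^sub>3\<^sub>k\<close> of the \<open>k\<close>-th term of the series is a quotient of the
  kind that the nonterminating \<open>q\<close>-Saalschuetz sum evaluates. Write this sum as an integral of
  infinite products over the circle \<open>\<bar>\<zeta>\<bar> = 1/\<sigma>\<close>, where \<open>\<zeta> = w/\<sigma>\<close>. The index \<open>k\<close> then only
  affects the factors with \<open>r q\<^sup>3\<^sup>k/\<zeta>\<close>, with \<open>A B C q\<^sup>3\<^sup>k \<zeta>\<close> and one theta function, whose
  quasi-periodicity turns the argument of the series into \<open>(\<kappa>\<zeta>)\<^sup>3\<close>. So all terms of the series are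
  integrals over the same circle, and under the integral sign the sum over \<open>k\<close> is Rogers'
  very-well-poised \<open>6\<phi>5\<close> sum in base \<open>q\<^sup>3\<close> with parameters \<open>b\<close>, \<open>q b\<close>, \<open>q\<^sup>2 b\<close> for \<open>b = r/\<zeta>\<close>. It
  converges because \<open>\<bar>\<kappa>\<bar>/\<sigma> < 1\<close>, and its value supplies the remaining factors of the
  integrand. The exchange is carried out in \<open>cubic_integral_representation\<close>.

  The two evaluations, \<open>rogers_sum\<close> and \<open>saalschuetz_integral\<close>, are proved in the same way: a
  contiguous relation multiplies one parameter by the base, its iteration leads to a limit, and
  a special case fixes the constant. For the series the relation is a telescoping sum and the
  special case is a series with a single nonzero term. For the integral the relation is
  that of an integrand of the form \<open>G \<zeta> - G (q \<zeta>)\<close>, whose integral over the circle vanishes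
  by Cauchy's theorem. In the special case the integrand consists of the factors
  depending on \<open>1/\<zeta>\<close> only, and is a power series in \<open>1/\<zeta>\<close> with constant term \<open>1\<close>; the factors that complete the theta functions are then attached by the contiguous relation, too.
\<close>

section \<open>Shifted factorials and their infinite products\<close>

lemma qpoch_0 [simp]: "qpoch a q 0 = 1"
  by (simp add: qpoch_def)

lemma qpoch_Suc: "qpoch a q (Suc k) = qpoch a q k * (1 - a * q ^ k)"
  by (simp add: qpoch_def)

lemma qpoch_add: "qpoch a q (m + n) = qpoch a q m * qpoch (a * q ^ m) q n"
  by (induction n) (simp_all add: qpoch_Suc power_add mult_ac)

lemma qpoch_Suc_shift: "qpoch a q (Suc k) = (1 - a) * qpoch (a * q) q k"
  using qpoch_add[of a q 1 k] by (simp add: qpoch_Suc)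

lemma qpoch_tendsto:
  assumes "norm q < 1"
  shows   "(\<lambda>n. qpoch a q n) \<longlonglongrightarrow> qpoch_inf a q"
proof -
  have "summable (\<lambda>j. norm (1 - a * q ^ j - 1))"
    using assms by (simp add: norm_mult norm_power summable_mult summable_geometric)
  hence "convergent_prod (\<lambda>j. 1 - a * q ^ j)"
    by (intro abs_convergent_prod_imp_convergent_prod summable_imp_abs_convergent_prod)
  from convergent_prod_LIMSEQ[OF this]
  have "(\<lambda>n. qpoch a q (Suc n)) \<longlonglongrightarrow> qpoch_inf a q"
    by (simp add: qpoch_def qpoch_inf_def lessThan_Suc_atMost)
  thus ?thesis by (rule LIMSEQ_imp_Suc)
qed

text \<open>Identities between infinite products are obtained throughout as limits of identities between
  finite ones. This avoids the special treatment of vanishing factors that convergence of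
  infinite products requires.\<close>

lemma qpoch_inf_eqI:
  assumes "norm q < 1" "(\<lambda>n. qpoch a q n) \<longlonglongrightarrow> L"
  shows   "qpoch_inf a q = L"
  using qpoch_tendsto[OF assms(1)] assms(2) by (rule LIMSEQ_unique)

lemma qpoch_inf_zero_base [simp]: "qpoch_inf 0 q = 1"
  by (simp add: qpoch_inf_def)

lemma qpoch_inf_split:
  assumes "norm q < 1"
  shows   "qpoch_inf a q = qpoch a q k * qpoch_inf (a * q ^ k) q"
proof (rule qpoch_inf_eqI[OF assms])
  have "(\<lambda>n. qpoch a q k * qpoch (a * q ^ k) q n) \<longlonglongrightarrow> qpoch a q k * qpoch_inf (a * q ^ k) q"
    by (intro tendsto_intros qpoch_tendsto assms)
  hence "(\<lambda>n. qpoch a q (n + k)) \<longlonglongrightarrow> qpoch a q k * qpoch_inf (a * q ^ k) q"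
    by (simp add: qpoch_add [symmetric] add.commute)
  thus "(\<lambda>n. qpoch a q n) \<longlonglongrightarrow> qpoch a q k * qpoch_inf (a * q ^ k) q"
    by (rule LIMSEQ_offset)
qed

lemma qpoch_inf_step:
  assumes "norm q < 1"
  shows   "qpoch_inf a q = (1 - a) * qpoch_inf (a * q) q"
  using qpoch_inf_split[OF assms, of a 1] by (simp add: qpoch_Suc)

lemma mult_power_neq_one:
  fixes a q :: complex
  assumes "norm a < 1" "norm q < 1"
  shows   "a * q ^ j \<noteq> 1"
proof
  assume "a * q ^ j = 1"
  hence "norm a * norm q ^ j = 1" by (metis norm_mult norm_one norm_power)
  moreover have "norm a * norm q ^ j \<le> norm a * 1"
    using assms by (intro mult_left_mono power_le_one) auto
  ultimately show False using assms by simp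
qed

lemma qpoch_nonzero:
  assumes "norm a < 1" "norm q < 1"
  shows   "qpoch a q k \<noteq> 0"
proof -
  have "1 - a * q ^ j \<noteq> 0" for j
    using mult_power_neq_one[OF assms, of j] by (metis right_minus_eq)
  thus ?thesis by (simp add: qpoch_def)
qed

text \<open>All interchanges of limits below rest on bounds for \<open>(a;q)\<^sub>k\<close> and \<open>1 / (a;q)\<^sub>k\<close> that depend
  neither on \<open>k\<close> nor on the position of \<open>a\<close> in a closed disc. Both come from
  \<open>1 + t \<le> exp t\<close>.\<close>

lemma prod_one_plus_geometric_le:
  fixes c t :: real
  assumes "0 \<le> c" "0 \<le> t" "t < 1"
  shows   "(\<Prod>j<k. 1 + c * t ^ j) \<le> exp (c / (1 - t))"
proof -
  have "(\<Prod>j<k. 1 + c * t ^ j) \<le> (\<Prod>j<k. exp (c * t ^ j))"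
    using assms by (intro prod_mono) (auto intro!: exp_ge_add_one_self)
  also have "\<dots> = exp (c * (\<Sum>j<k. t ^ j))"
    by (simp add: exp_sum sum_distrib_left)
  also have "(\<Sum>j<k. t ^ j) \<le> (\<Sum>j. t ^ j)"
    using assms by (intro sum_le_suminf summable_geometric) auto
  also have "(\<Sum>j. t ^ j) = 1 / (1 - t)"
    using assms by (intro suminf_geometric) auto
  finally show ?thesis using assms
    by (simp add: mult_left_mono)
qed

lemma norm_qpoch_le:
  assumes "norm a \<le> c" "norm q < 1"
  shows   "norm (qpoch a q k) \<le> exp (c / (1 - norm q))"
proof -
  have "norm (qpoch a q k) \<le> (\<Prod>j<k. 1 + c * norm q ^ j)"
    unfolding qpoch_def prod_norm [symmetric]
  proof (intro prod_mono conjI norm_ge_zero)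
    fix j
    have "norm (1 - a * q ^ j) \<le> 1 + norm (a * q ^ j)"
      by (metis norm_one norm_triangle_ineq4)
    also have "\<dots> \<le> 1 + c * norm q ^ j"
      using assms by (simp add: norm_mult norm_power mult_right_mono)
    finally show "norm (1 - a * q ^ j) \<le> 1 + c * norm q ^ j" .
  qed
  also have "\<dots> \<le> exp (c / (1 - norm q))"
    by (rule prod_one_plus_geometric_le) (use assms order_trans[OF norm_ge_zero assms(1)] in auto)
  finally show ?thesis .
qed

text \<open>A single factor obeys \<open>1 / (1 - t) \<le> 1 + t / (1 - c)\<close> for \<open>0 \<le> t \<le> c\<close>, so that
  the reciprocals, too, are bounded by a product as in \<open>prod_one_plus_geometric_le\<close>.\<close>

lemma norm_inverse_qpoch_le:
  assumes "norm a \<le> c" "c < 1" "norm q < 1"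
  shows   "norm (inverse (qpoch a q k)) \<le> exp (c / (1 - c) / (1 - norm q))"
proof -
  have c: "0 \<le> c" using assms(1) norm_ge_zero order_trans by blast
  have "norm (inverse (qpoch a q k)) = (\<Prod>j<k. inverse (norm (1 - a * q ^ j)))"
    unfolding qpoch_def norm_inverse prod_norm [symmetric] by (rule prod_inversef [symmetric, unfolded o_def])
  also have "\<dots> \<le> (\<Prod>j<k. 1 + (c / (1 - c)) * norm q ^ j)"
  proof (intro prod_mono conjI)
    fix j
    define t where "t = c * norm q ^ j"
    have t: "0 \<le> t" "t \<le> c"
      using assms c by (auto simp: t_def intro!: mult_left_le power_le_one)
    have "norm (a * q ^ j) \<le> t"
      using assms by (simp add: t_def norm_mult norm_power mult_right_mono)
    moreover have "1 - norm (a * q ^ j) \<le> norm (1 - a * q ^ j)"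
      by (metis norm_one norm_triangle_ineq2)
    ultimately have "1 - t \<le> norm (1 - a * q ^ j)" by linarith
    hence "inverse (norm (1 - a * q ^ j)) \<le> inverse (1 - t)"
      using t assms by (intro le_imp_inverse_le) auto
    also have "\<dots> = 1 + t / (1 - t)"
      using t assms by (simp add: field_simps)
    also have "t / (1 - t) \<le> t / (1 - c)"
      using t assms by (intro divide_left_mono mult_pos_pos) auto
    finally show "inverse (norm (1 - a * q ^ j)) \<le> 1 + (c / (1 - c)) * norm q ^ j"
      by (simp add: t_def)
  qed auto
  also have "\<dots> \<le> exp (c / (1 - c) / (1 - norm q))"
    by (rule prod_one_plus_geometric_le) (use assms c in auto)
  finally show ?thesis .
qed

lemma norm_qpoch_inf_le:
  assumes "norm a \<le> c" "norm q < 1"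
  shows   "norm (qpoch_inf a q) \<le> exp (c / (1 - norm q))"
  by (rule LIMSEQ_le_const2[OF tendsto_norm[OF qpoch_tendsto]])
     (use assms norm_qpoch_le in auto)

lemma qpoch_inf_nonzero:
  assumes "norm a < 1" "norm q < 1"
  shows   "qpoch_inf a q \<noteq> 0"
proof
  assume 0: "qpoch_inf a q = 0"
  define E where "E = exp (norm a / (1 - norm a) / (1 - norm q))"
  have "inverse E \<le> norm (qpoch a q k)" for k
  proof -
    have "inverse (norm (qpoch a q k)) \<le> E"
      using norm_inverse_qpoch_le[of a "norm a" q k] assms by (simp add: E_def norm_inverse)
    hence "inverse E \<le> inverse (inverse (norm (qpoch a q k)))"
      using qpoch_nonzero[OF assms] by (intro le_imp_inverse_le) auto
    thus ?thesis by simp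
  qed
  hence "inverse E \<le> norm (qpoch_inf a q)"
    by (intro LIMSEQ_le_const[OF tendsto_norm[OF qpoch_tendsto[OF assms(2)]]]) auto
  with 0 show False by (simp add: E_def)
qed

lemma norm_inverse_qpoch_inf_le:
  assumes "norm a \<le> c" "c < 1" "norm q < 1"
  shows   "norm (inverse (qpoch_inf a q)) \<le> exp (c / (1 - c) / (1 - norm q))"
  by (rule LIMSEQ_le_const2[OF tendsto_norm[OF tendsto_inverse[OF qpoch_tendsto]]])
     (use assms norm_inverse_qpoch_le qpoch_inf_nonzero[of a q] in auto)

lemma uniform_limit_qpoch:
  assumes "norm q < 1"
  shows   "uniform_limit (cball 0 R) (\<lambda>n a. qpoch a q n) (\<lambda>a. qpoch_inf a q) sequentially"
proof -
  have "uniformly_convergent_on (cball 0 R) (\<lambda>N a. \<Sum>n<N. norm (- (a * q ^ n)))"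
  proof (rule Weierstrass_m_test')
    show "norm (norm (- (a * q ^ n))) \<le> R * norm q ^ n" if "a \<in> cball 0 R" for n a
      using that by (auto simp: norm_mult norm_power intro!: mult_right_mono)
    show "summable (\<lambda>n. R * norm q ^ n)"
      using assms by (intro summable_mult summable_geometric) auto
  qed
  hence "uniformly_convergent_on (cball 0 R) (\<lambda>N a. \<Prod>n<N. 1 + - (a * q ^ n))"
    by (intro uniformly_convergent_on_prod) (auto intro!: continuous_intros)
  hence "uniform_limit (cball 0 R) (\<lambda>n a. qpoch a q n) (\<lambda>a. lim (\<lambda>n. qpoch a q n)) sequentially"
    unfolding qpoch_def by (simp add: uniformly_convergent_uniform_limit_iff)
  thus ?thesis
    by (simp add: limI[OF qpoch_tendsto[OF assms]])
qed

lemma holomorphic_qpoch_inf_UNIV: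
  assumes "norm q < 1"
  shows   "(\<lambda>a. qpoch_inf a q) holomorphic_on UNIV"
proof (rule holomorphic_uniform_sequence)
  show "(\<lambda>a. qpoch a q n) holomorphic_on UNIV" for n
    unfolding qpoch_def by (intro holomorphic_intros)
  fix z :: complex
  have "uniform_limit (cball z 1) (\<lambda>n a. qpoch a q n) (\<lambda>a. qpoch_inf a q) sequentially"
    by (rule uniform_limit_on_subset[OF uniform_limit_qpoch[OF assms, of "norm z + 1"]])
       (simp add: cball_subset_cball_iff)
  thus "\<exists>d>0. cball z d \<subseteq> UNIV \<and>
          uniform_limit (cball z d) (\<lambda>n a. qpoch a q n) (\<lambda>a. qpoch_inf a q) sequentially"
    by (intro exI[of _ 1]) auto
qed auto

lemma holomorphic_qpoch_inf [holomorphic_intros]: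
  assumes "f holomorphic_on S" "norm q < 1"
  shows   "(\<lambda>z. qpoch_inf (f z) q) holomorphic_on S"
  using holomorphic_on_compose_gen[OF assms(1) holomorphic_qpoch_inf_UNIV[OF assms(2)]]
  by (simp add: o_def)

lemma continuous_on_qpoch_inf [continuous_intros]:
  assumes "continuous_on S f" "norm q < 1"
  shows   "continuous_on S (\<lambda>z. qpoch_inf (f z) q)"
  using continuous_on_compose2[OF holomorphic_on_imp_continuous_on
          [OF holomorphic_qpoch_inf_UNIV[OF assms(2)]] assms(1)] by simp

lemma tendsto_qpoch_inf [tendsto_intros]:
  assumes "(f \<longlongrightarrow> l) F" "norm q < 1"
  shows   "((\<lambda>x. qpoch_inf (f x) q) \<longlongrightarrow> qpoch_inf l q) F"
  using continuous_on_tendsto_compose[OF holomorphic_on_imp_continuous_on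
          [OF holomorphic_qpoch_inf_UNIV[OF assms(2)]] assms(1)] by simp

lemma holomorphic_qpoch [holomorphic_intros]:
  "f holomorphic_on S \<Longrightarrow> (\<lambda>z. qpoch (f z) q n) holomorphic_on S"
  unfolding qpoch_def by (intro holomorphic_intros)

lemma continuous_on_qpoch [continuous_intros]:
  "continuous_on S f \<Longrightarrow> continuous_on S (\<lambda>z. qpoch (f z) q n)"
  unfolding qpoch_def by (intro continuous_intros)

text \<open>The next identities regroup the factors \<open>1 - a q\<^sup>j\<close> by residue classes of \<open>j\<close>, or collect
  the factors \<open>1 - \<epsilon> a q\<^sup>j\<close> for all roots of unity \<open>\<epsilon>\<close> of a given order. They pass between the
  bases \<open>q\<close>, \<open>q\<^sup>2\<close> and \<open>q\<^sup>3\<close>.\<close>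

lemma qpoch_inf_eq_subseq:
  assumes "norm q < 1" "strict_mono s" "(\<lambda>n. qpoch a q (s n)) \<longlonglongrightarrow> L"
  shows   "qpoch_inf a q = L"
  using LIMSEQ_subseq_LIMSEQ[OF qpoch_tendsto[OF assms(1), of a] assms(2)] assms(3)
  by (auto simp: o_def intro: LIMSEQ_unique)

lemma norm_power_less_one:
  fixes q :: complex
  assumes "norm q < 1" "n > 0"
  shows   "norm (q ^ n) < 1"
  using assms by (simp add: norm_power power_less_one_iff)

lemma qpoch_triple: "qpoch a q (3 * k) = qpoch a (q ^ 3) k * qpoch (q * a) (q ^ 3) k * qpoch (q\<^sup>2
    * a) (q ^ 3) k"
proof (induction k)
  case (Suc k)
  have "3 * Suc k = Suc (Suc (Suc (3 * k)))" by simp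
  moreover have "q ^ (3 * k) = (q ^ 3) ^ k" by (rule power_mult)
  ultimately show ?case using Suc
    by (simp only: qpoch_Suc power_Suc) (simp add: power2_eq_square mult_ac)
qed simp

lemma qpoch_inf_triple:
  assumes "norm q < 1"
  shows   "qpoch_inf a q = qpoch_inf a (q ^ 3) * qpoch_inf (q * a) (q ^ 3) * qpoch_inf (q\<^sup>2 * a) (q ^ 3)"
proof (rule qpoch_inf_eq_subseq[OF assms])
  show "strict_mono (\<lambda>n::nat. 3 * n)" by (simp add: strict_mono_def)
  show "(\<lambda>n. qpoch a q (3 * n)) \<longlonglongrightarrow>
          qpoch_inf a (q ^ 3) * qpoch_inf (q * a) (q ^ 3) * qpoch_inf (q\<^sup>2 * a) (q ^ 3)"
    unfolding qpoch_triple
    using norm_power_less_one[OF assms, of 3] by (intro tendsto_intros qpoch_tendsto) auto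
qed

lemma qpoch_double: "qpoch a q (2 * k) = qpoch a (q\<^sup>2) k * qpoch (q * a) (q\<^sup>2) k"
proof (induction k)
  case (Suc k)
  have "2 * Suc k = Suc (Suc (2 * k))" by simp
  moreover have "q ^ (2 * k) = (q\<^sup>2) ^ k" by (rule power_mult)
  ultimately show ?case using Suc
    by (simp only: qpoch_Suc power_Suc) (simp add: mult_ac)
qed simp

lemma qpoch_plus_minus: "qpoch a q k * qpoch (- a) q k = qpoch (a\<^sup>2) (q\<^sup>2) k"
  by (induction k) (simp_all add: qpoch_Suc algebra_simps power2_eq_square power_mult_distrib)

lemma qpoch_inf_square:
  assumes "norm q < 1" "s\<^sup>2 = q"
  shows   "qpoch_inf a q * qpoch_inf (- a) q * qpoch_inf (s * a) q * qpoch_inf (- (s * a)) q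
             = qpoch_inf (a\<^sup>2) q"
proof (rule sym, rule qpoch_inf_eq_subseq[OF assms(1)])
  show "strict_mono (\<lambda>n::nat. 2 * n)" by (simp add: strict_mono_def)
  have "qpoch (a\<^sup>2) q (2 * n) = (qpoch a q n * qpoch (- a) q n) * (qpoch (s * a) q n * qpoch (- (s
      * a)) q n)" for n
    unfolding qpoch_plus_minus qpoch_double by (simp add: assms power_mult_distrib)
  moreover have "(\<lambda>n. (qpoch a q n * qpoch (- a) q n) * (qpoch (s * a) q n * qpoch (- (s * a)) q n)) \<longlonglongrightarrow>
       (qpoch_inf a q * qpoch_inf (- a) q) * (qpoch_inf (s * a) q * qpoch_inf (- (s * a)) q)"
    by (intro tendsto_intros qpoch_tendsto assms)
  ultimately show "(\<lambda>n. qpoch (a\<^sup>2) q (2 * n)) \<longlonglongrightarrow>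
      qpoch_inf a q * qpoch_inf (- a) q * qpoch_inf (s * a) q * qpoch_inf (- (s * a)) q"
    by (simp add: mult_ac)
qed

lemma qpoch_cube:
  assumes "1 + w + w\<^sup>2 = (0::complex)"
  shows   "qpoch a q k * qpoch (w * a) q k * qpoch (w\<^sup>2 * a) q k = qpoch (a ^ 3) (q ^ 3) k"
proof (induction k)
  case (Suc k)
  have w3: "w ^ 3 = 1"
  proof -
    have "w ^ 3 - 1 = (w - 1) * (1 + w + w\<^sup>2)" by algebra
    with assms show ?thesis by simp
  qed
  have *: "(1 - t) * (1 - w * t) * (1 - w\<^sup>2 * t) = 1 - t ^ 3" for t
    using assms w3 by algebra
  have "qpoch a q (Suc k) * qpoch (w * a) q (Suc k) * qpoch (w\<^sup>2 * a) q (Suc k) =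
        (qpoch a q k * qpoch (w * a) q k * qpoch (w\<^sup>2 * a) q k) *
        ((1 - a * q ^ k) * (1 - w * (a * q ^ k)) * (1 - w\<^sup>2 * (a * q ^ k)))"
    by (simp add: qpoch_Suc mult_ac)
  also have "\<dots> = qpoch (a ^ 3) (q ^ 3) (Suc k)"
    unfolding Suc.IH * by (simp add: qpoch_Suc power_mult_distrib power_mult [symmetric] mult.commute)
  finally show ?case .
qed simp

lemma qpoch_inf_cube:
  assumes "norm q < 1" "1 + w + w\<^sup>2 = (0::complex)"
  shows   "qpoch_inf a q * qpoch_inf (w * a) q * qpoch_inf (w\<^sup>2 * a) q = qpoch_inf (a ^ 3) (q ^ 3)"
proof (rule sym, rule qpoch_inf_eqI)
  show "norm (q ^ 3) < 1" using norm_power_less_one[OF assms(1), of 3] by simp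
  show "(\<lambda>n. qpoch (a ^ 3) (q ^ 3) n) \<longlonglongrightarrow>
          qpoch_inf a q * qpoch_inf (w * a) q * qpoch_inf (w\<^sup>2 * a) q"
    unfolding qpoch_cube[OF assms(2), symmetric] by (intro tendsto_intros qpoch_tendsto assms)
qed

section \<open>Rogers' very-well-poised sum\<close>

text \<open>The \<open>k\<close>-th term of Rogers' series is written with \<open>u = 1 / d\<close> in place of the last numerator
  parameter \<open>d\<close>: since \<open>(d;p)\<^sub>k u\<^sup>k\<close> is the product of the \<open>u - p\<^sup>j\<close>, the terms are polynomial in
  \<open>u\<close> apart from the factor \<open>(a p u;p)\<^sub>k\<close> in the denominator. So \<open>u = 0\<close>, that is \<open>d = \<infinity>\<close>,
  is an ordinary point, which the argument below needs as a limit.\<close>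

definition well_poised_coeff :: "complex \<Rightarrow> complex \<Rightarrow> complex \<Rightarrow> complex \<Rightarrow> nat \<Rightarrow> complex" where
  "well_poised_coeff a b c p k =
     qpoch a p k * qpoch b p k * qpoch c p k /
     (qpoch p p k * qpoch (a * p / b) p k * qpoch (a * p / c) p k) * (a * p / (b * c)) ^ k"

definition rogers_term :: "complex \<Rightarrow> complex \<Rightarrow> complex \<Rightarrow> complex \<Rightarrow> complex \<Rightarrow> nat \<Rightarrow> complex" where
  "rogers_term a b c p u k =
     (1 - a * p ^ (2 * k)) * well_poised_coeff a b c p k *
     (\<Prod>j<k. u - p ^ j) / qpoch (a * p * u) p k"

lemma well_poised_coeff_Suc:
  "well_poised_coeff a b c p (Suc k) = well_poised_coeff a b c p k *
     ((1 - a * p ^ k) * (1 - b * p ^ k) * (1 - c * p ^ k) * (a * p / (b * c)) /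
      ((1 - p ^ Suc k) * (1 - a * p / b * p ^ k) * (1 - a * p / c * p ^ k)))"
  by (simp add: well_poised_coeff_def qpoch_Suc times_divide_times_eq mult_ac)

lemma prod_diff_scaled:
  fixes u p :: complex
  shows "(\<Prod>j<Suc k. p * u - p ^ j) = (p * u - 1) * p ^ k * (\<Prod>j<k. u - p ^ j)"
proof -
  have "(\<Prod>j<Suc k. p * u - p ^ j) = (p * u - 1) * (\<Prod>j<k. p * (u - p ^ j))"
    by (subst prod.lessThan_Suc_shift) (simp add: algebra_simps)
  thus ?thesis by (simp add: prod.distrib)
qed

text \<open>The closed forms of Rogers' sum at \<open>u\<close> and at \<open>p u\<close> differ by finitely many factors, and
  these are the factors in front of the two terms. The partial sums of the combination
  consist of the factors that consecutive terms have in common.\<close>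

lemma rogers_telescoping:
  fixes a b c p u :: complex
  assumes p: "norm p < 1" and nz: "b \<noteq> 0" "c \<noteq> 0"
    and lt: "norm (a * p / b) < 1" "norm (a * p / c) < 1" "norm (a * p * u) < 1"
  shows "(\<Sum>k\<le>n. (1 - a * p * u) * (1 - a * p * u / (b * c)) * rogers_term a b c p u k
                - (1 - a * p * u / b) * (1 - a * p * u / c) * rogers_term a b c p (p * u) k)
       = - (1 - a * p * u) * u * well_poised_coeff a b c p n *
         ((1 - a * p ^ n) * (1 - b * p ^ n) * (1 - c * p ^ n)) * (a * p / (b * c)) *
         (\<Prod>j<n. u - p ^ j) / qpoch (a * p * u) p (Suc n)"
proof (induction n)
  case 0
  have "1 - a * p * u \<noteq> 0" using lt(3) by auto
  thus ?case using nz
    by (simp add: rogers_term_def well_poised_coeff_def qpoch_Suc) (simp add: field_simps)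
next
  case (Suc n)
  \<comment> \<open>With this ratio as a variable, \<open>a p = g b c\<close> is the only relation between the
      parameters, and the induction step becomes a polynomial identity.\<close>
  define g where "g = a * p / (b * c)"
  define P where "P = p ^ n"
  define V where "V = (\<Prod>j<n. u - p ^ j)"
  define W where "W = well_poised_coeff a b c p n"
  define Z where "Z = qpoch (a * p * u) p (Suc n)"
  have g: "a * p = g * b * c" "a * p / b = g * c" "a * p / c = g * b"
    using nz by (auto simp: g_def field_simps)
  have g': "a * p * u / (b * c) = g * u" "a * p * u / b = g * c * u" "a * p * u / c = g * b * u"
    using nz by (auto simp: g_def field_simps)
  have nz': "1 - p * P \<noteq> 0" "1 - g * c * P \<noteq> 0" "1 - g * b * P \<noteq> 0"
       "1 - a * p * u \<noteq> 0" "1 - a * p\<^sup>2 * P * u \<noteq> 0" "Z \<noteq> 0"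
  proof -
    show "1 - p * P \<noteq> 0" using mult_power_neq_one[of p p n] p by (simp add: P_def)
    show "1 - g * c * P \<noteq> 0" using mult_power_neq_one[OF lt(1)[unfolded g(2)] p, of n] by (simp add: P_def)
    show "1 - g * b * P \<noteq> 0" using mult_power_neq_one[OF lt(2)[unfolded g(3)] p, of n] by (simp add: P_def)
    show "1 - a * p * u \<noteq> 0" using lt(3) by auto
    have "a * p\<^sup>2 * P * u = a * p * u * p ^ Suc n" by (simp add: P_def power2_eq_square)
    thus "1 - a * p\<^sup>2
        * P * u \<noteq> 0" using mult_power_neq_one[OF lt(3) p, of "Suc n"] by (metis right_minus_eq)
    show "Z \<noteq> 0" unfolding Z_def by (rule qpoch_nonzero[OF lt(3) p])
  qed
  have W': "well_poised_coeff a b c p (Suc n) = W * ((1 - a * P) * (1 - b * P) * (1 - c * P) * g /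
              ((1 - p * P) * (1 - g * c * P) * (1 - g * b * P)))"
    unfolding well_poised_coeff_Suc W_def P_def g by (simp add: g_def)
  have Z1: "qpoch (a * p * u) p (Suc (Suc n)) = Z * (1 - a * p\<^sup>2 * P * u)"
    unfolding qpoch_Suc[of _ _ "Suc n"] Z_def by (simp add: P_def power2_eq_square mult_ac)
  have "qpoch (a * p * u) p (Suc (Suc n)) = (1 - a * p * u) * qpoch (a * p * (p * u)) p (Suc n)"
    by (subst qpoch_Suc_shift) (simp add: mult_ac)
  hence Z2: "qpoch (a * p * (p * u)) p (Suc n) = Z * (1 - a * p\<^sup>2 * P * u) / (1 - a * p * u)"
    unfolding nonzero_eq_divide_eq[OF nz'(4)] Z1 by (simp add: mult.commute)
  have V1: "(\<Prod>j<Suc n. u - p ^ j) = V * (u - P)" by (simp add: V_def P_def)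
  have V2: "(\<Prod>j<Suc n. p * u - p ^ j) = (p * u - 1) * P * V"
    unfolding prod_diff_scaled by (simp add: V_def P_def)
  have "2 * Suc n = 2 + (n + n)" by simp
  hence pw: "p ^ (2 * Suc n) = p\<^sup>2 * P\<^sup>2" "p ^ Suc n = p * P"
    by (simp_all only: P_def power_add power2_eq_square power_Suc)
  define D where "D = (1 - p * P) * (1 - g * c * P) * (1 - g * b * P)"
  define E where "E = (1 - a * P) * (1 - b * P) * (1 - c * P)"
  have D0: "D \<noteq> 0" using nz' by (simp add: D_def)
  have T1: "rogers_term a b c p u (Suc n) =
      (1 - a * (p\<^sup>2 * P\<^sup>2)) * (W * (E * g / D)) * (V * (u - P)) / Z"
    unfolding rogers_term_def W' V1 pw Z_def D_def E_def ..
  have T2: "rogers_term a b c p (p * u) (Suc n) =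
      (1 - a * (p\<^sup>2 * P\<^sup>2)) * (W * (E * g / D)) * ((p * u - 1) * P * V) /
              (Z * (1 - a * p\<^sup>2 * P * u) / (1 - a * p * u))"
    unfolding rogers_term_def W' V2 pw Z2 D_def E_def ..
  have main: "(1 - a * p\<^sup>2 * P\<^sup>2) * ((1 - g * u) * (u - P) * (1 - a * p\<^sup>2 * P * u)
                 - (1 - g * c * u) * (1 - g * b * u) * ((p * u - 1) * P))
              = - u * ((1 - a * (p * P)) * (1 - b * (p * P)) * (1 - c * (p * P)) * g * (u - P)
                 - D * (1 - a * p\<^sup>2 * P * u))"
    unfolding D_def using g(1) by algebra
  have alg1: "- x * u * W * E * g * V / Z + (x * X * (M * (W * (E * g / D)) * (V * v) / Z)
        - Y1 * Y2 * (M * (W * (E * g / D)) * (t * P * V) / (Z * y / x)))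
      = x * W * E * g * V / (Z * D * y) * (- u * D * y + M * (X * v * y - Y1 * Y2 * (t * P)))"
    if "x \<noteq> 0" "y \<noteq> 0" for x X M v Y1 Y2 t y
    using that D0 nz'(6) by (simp add: divide_simps) (simp add: algebra_simps)
  have alg2: "x * W * E * g * V / (Z * D * y) * (- u * D * y + - u * (F * g * v - D * y))
      = - x * u * (W * (E * g / D)) * F * g * (V * v) / (Z * y)"
    if "y \<noteq> 0" for x y F v
    using that D0 nz'(6) by (simp add: divide_simps) (simp add: algebra_simps)
  have "(\<Sum>k\<le>Suc n. (1 - a * p * u) * (1 - a * p * u / (b * c)) * rogers_term a b c p u k
                - (1 - a * p * u / b) * (1 - a * p * u / c) * rogers_term a b c p (p * u) k)
      = - (1 - a * p * u) * u * W * E * g * V / Z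
        + ((1 - a * p * u) * (1 - g * u) *
            ((1 - a * (p\<^sup>2 * P\<^sup>2)) * (W * (E * g / D)) * (V * (u - P)) / (Z ))
        - (1 - g * c * u) * (1 - g * b * u) *
            ((1 - a * (p\<^sup>2 * P\<^sup>2)) * (W * (E * g / D)) * ((p * u - 1) * P * V) /
              (Z * (1 - a * p\<^sup>2 * P * u) / (1 - a * p * u))))"
    unfolding sum.atMost_Suc Suc.IH T1 T2
    unfolding g'
    unfolding Z_def [symmetric] V_def [symmetric] W_def [symmetric] P_def [symmetric] g_def [symmetric]
      E_def by (simp only: mult.assoc)
  also have "\<dots> = (1 - a * p * u) * W * E * g * V / (Z * D * (1 - a * p\<^sup>2 * P * u)) *
       (- u * D * (1 - a * p\<^sup>2 * P * u) + (1 - a * p\<^sup>2 * P\<^sup>2) * ((1 - g * u) * (u - P) * (1 - a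
           * p\<^sup>2 * P * u)
                 - (1 - g * c * u) * (1 - g * b * u) * ((p * u - 1) * P)))"
    unfolding mult.assoc[of a "p\<^sup>2" "P\<^sup>2"] by (rule alg1[OF nz'(4,5)])
  also have "\<dots> = - (1 - a * p * u) * u * (W * (E * g / D)) *
     ((1 - a * (p * P)) * (1 - b * (p * P)) * (1 - c * (p * P))) * g * (V * (u - P)) / (Z * (1 - a
         * p\<^sup>2 * P * u))"
    unfolding main by (rule alg2[OF nz'(5)])
  also have "\<dots> = - (1 - a * p * u) * u * well_poised_coeff a b c p (Suc n) *
         ((1 - a * p ^ Suc n) * (1 - b * p ^ Suc n) * (1 - c * p ^ Suc n)) * (a * p / (b * c)) *
         (\<Prod>j<Suc n. u - p ^ j) / qpoch (a * p * u) p (Suc (Suc n))"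
    unfolding W' Z1 V1 pw by (simp only: D_def E_def g_def)
  finally show ?case .
qed

lemma norm_prod_diff_power_le:
  fixes u p :: complex
  assumes "norm u \<le> U" "0 < U" "norm p < 1"
  shows   "norm (\<Prod>j<k. u - p ^ j) \<le> U ^ k * exp (1 / U / (1 - norm p))"
proof -
  have "norm (\<Prod>j<k. u - p ^ j) \<le> (\<Prod>j<k. U * (1 + 1 / U * norm p ^ j))"
    unfolding prod_norm [symmetric]
  proof (intro prod_mono conjI norm_ge_zero)
    fix j
    have "norm (u - p ^ j) \<le> norm u + norm (p ^ j)" by (rule norm_triangle_ineq4)
    also have "\<dots> \<le> U + norm p ^ j" using assms by (simp add: norm_power)
    also have "\<dots> = U * (1 + 1 / U * norm p ^ j)" using assms by (simp add: field_simps)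
    finally show "norm (u - p ^ j) \<le> U * (1 + 1 / U * norm p ^ j)" .
  qed
  also have "\<dots> = U ^ k * (\<Prod>j<k. 1 + 1 / U * norm p ^ j)"
    by (simp add: prod.distrib)
  also have "\<dots> \<le> U ^ k * exp (1 / U / (1 - norm p))"
    using assms by (intro mult_left_mono prod_one_plus_geometric_le) auto
  finally show ?thesis .
qed

lemma norm_well_poised_coeff_le:
  assumes p: "norm p < 1" and lt: "norm (a * p / b) < 1" "norm (a * p / c) < 1"
  obtains C where "C \<ge> 0" "\<And>k. norm (well_poised_coeff a b c p k) \<le> C * norm (a * p / (b * c)) ^ k"
proof -
  define E where "E = (\<lambda>x. exp (norm (x::complex) / (1 - norm p)))"
  define I where "I = (\<lambda>x. exp (norm (x::complex) / (1 - norm x) / (1 - norm p)))"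
  define C where "C = E a * E b * E c * (I p * I (a * p / b) * I (a * p / c))"
  have "norm (well_poised_coeff a b c p k) \<le> C * norm (a * p / (b * c)) ^ k" for k
  proof -
    have "norm (well_poised_coeff a b c p k) =
        norm (qpoch a p k) * norm (qpoch b p k) * norm (qpoch c p k) *
        (norm (inverse (qpoch p p k)) * norm (inverse (qpoch (a * p / b) p k)) *
         norm (inverse (qpoch (a * p / c) p k))) * norm (a * p / (b * c)) ^ k"
      by (simp add: well_poised_coeff_def norm_mult norm_divide norm_power norm_inverse field_simps)
    also have "\<dots> \<le> C * norm (a * p / (b * c)) ^ k"
      unfolding C_def E_def I_def
      by (intro mult_right_mono mult_mono norm_qpoch_le norm_inverse_qpoch_le mult_nonneg_nonneg)
         (use p lt in auto)
    finally show ?thesis .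
  qed
  moreover have "C \<ge> 0" by (simp add: C_def E_def I_def)
  ultimately show ?thesis using that by blast
qed

text \<open>The bound is uniform in \<open>u\<close> on a whole disc, so that it serves both for the convergence of the
  series and as a majorant when \<open>u\<close> tends to \<open>0\<close>.\<close>

lemma norm_rogers_core_le:
  assumes p: "norm p < 1" and lt: "norm (a * p / b) < 1" "norm (a * p / c) < 1"
    and U: "0 < U" "norm (a * p) * U < 1"
  obtains C where "C \<ge> 0" "\<And>u k. norm u \<le> U \<Longrightarrow>
    norm (well_poised_coeff a b c p k * (\<Prod>j<k. u - p ^ j) / qpoch (a * p * u) p k)
      \<le> C * (norm (a * p / (b * c)) * U) ^ k"
proof -
  obtain C0 where C0: "C0 \<ge> 0"
      "\<And>k. norm (well_poised_coeff a b c p k) \<le> C0 * norm (a * p / (b * c)) ^ k"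
    using norm_well_poised_coeff_le[OF p lt] by metis
  define s where "s = norm (a * p) * U"
  define C where "C = C0 * exp (1 / U / (1 - norm p)) * exp (s / (1 - s) / (1 - norm p))"
  have "norm (well_poised_coeff a b c p k * (\<Prod>j<k. u - p ^ j) / qpoch (a * p * u) p k)
      \<le> C * (norm (a * p / (b * c)) * U) ^ k" if u: "norm u \<le> U" for u k
  proof -
    have "norm (well_poised_coeff a b c p k * (\<Prod>j<k. u - p ^ j) / qpoch (a * p * u) p k) =
       norm (well_poised_coeff a b c p k) * norm (\<Prod>j<k. u - p ^ j) * norm (inverse (qpoch (a * p
           * u) p k))"
      by (simp add: norm_mult norm_divide norm_inverse divide_inverse)
    also have "norm (a * p * u) \<le> s"
      unfolding s_def norm_mult[of _ u] using u by (intro mult_left_mono) auto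
    hence "norm (well_poised_coeff a b c p k) * norm (\<Prod>j<k. u - p ^ j) * norm (inverse (qpoch (a
        * p * u) p k))
       \<le> (C0 * norm (a * p / (b * c)) ^ k) * (U ^ k * exp (1 / U / (1 - norm p)))
          * exp (s / (1 - s) / (1 - norm p))"
      using C0(1) U by (intro mult_mono C0(2) norm_prod_diff_power_le u U p norm_inverse_qpoch_le
        mult_nonneg_nonneg) (auto simp: s_def)
    also have "\<dots> = C * (norm (a * p / (b * c)) * U) ^ k"
      by (simp add: C_def power_mult_distrib mult_ac)
    finally show ?thesis .
  qed
  moreover have "C \<ge> 0" using C0 by (simp add: C_def)
  ultimately show ?thesis using that by blast
qed

lemma norm_rogers_term_le:
  assumes p: "norm p < 1" and lt: "norm (a * p / b) < 1" "norm (a * p / c) < 1"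
    and U: "0 < U" "norm (a * p) * U < 1"
  obtains C where "\<And>u k. norm u \<le> U \<Longrightarrow>
    norm (rogers_term a b c p u k) \<le> C * (norm (a * p / (b * c)) * U) ^ k"
proof -
  obtain C0 where C0: "C0 \<ge> 0" "\<And>u k. norm u \<le> U \<Longrightarrow>
    norm (well_poised_coeff a b c p k * (\<Prod>j<k. u - p ^ j) / qpoch (a * p * u) p k)
      \<le> C0 * (norm (a * p / (b * c)) * U) ^ k"
    using norm_rogers_core_le[OF assms] by metis
  have "norm (rogers_term a b c p u k) \<le> (1 + norm a) * C0 * (norm (a * p / (b * c)) * U) ^ k"
    if u: "norm u \<le> U" for u k
  proof -
    have "norm (1 - a * p ^ (2 * k)) \<le> 1 + norm (a * p ^ (2 * k))"
      by (metis norm_one norm_triangle_ineq4)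
    also have "norm (a * p ^ (2 * k)) \<le> norm a"
      using p by (simp add: norm_mult norm_power mult_left_le power_le_one)
    finally have 1: "norm (1 - a * p ^ (2 * k)) \<le> 1 + norm a" by simp
    have "norm (rogers_term a b c p u k) = norm (1 - a * p ^ (2 * k)) *
       norm (well_poised_coeff a b c p k * (\<Prod>j<k. u - p ^ j) / qpoch (a * p * u) p k)"
      by (simp add: rogers_term_def norm_mult norm_divide)
    also have "\<dots> \<le> (1 + norm a) * (C0 * (norm (a * p / (b * c)) * U) ^ k)"
      by (intro mult_mono 1 C0(2) u) auto
    finally show ?thesis by (simp add: mult_ac)
  qed
  thus ?thesis using that by blast
qed

lemma rogers_contiguous:
  assumes p: "norm p < 1" and nz: "b \<noteq> 0" "c \<noteq> 0"
    and lt: "norm (a * p / b) < 1" "norm (a * p / c) < 1"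
    and U: "0 < U" "norm (a * p) * U < 1" "norm (a * p / (b * c)) * U < 1"
    and u: "norm u \<le> U"
  shows "(1 - a * p * u) * (1 - a * p * u / (b * c)) * (\<Sum>k. rogers_term a b c p u k)
       = (1 - a * p * u / b) * (1 - a * p * u / c) * (\<Sum>k. rogers_term a b c p (p * u) k)"
proof -
  define g where "g = norm (a * p / (b * c)) * U"
  obtain C where C: "\<And>u k. norm u \<le> U \<Longrightarrow> norm (rogers_term a b c p u k) \<le> C * g ^ k"
    using norm_rogers_term_le[OF p lt U(1,2)] unfolding g_def by metis
  obtain D where D: "\<And>u k. norm u \<le> U \<Longrightarrow>
    norm (well_poised_coeff a b c p k * (\<Prod>j<k. u - p ^ j) / qpoch (a * p * u) p k) \<le> D * g ^ k"
    using norm_rogers_core_le[OF p lt U(1,2)] unfolding g_def by metis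
  have g: "norm g < 1" "0 \<le> g" using U by (simp_all add: g_def norm_mult)
  have summ: "summable (rogers_term a b c p v)" if "norm v \<le> U" for v
    by (rule summable_comparison_test'[of "\<lambda>k. C * g ^ k" 0])
       (use C[OF that] g in \<open>auto intro!: summable_mult summable_geometric\<close>)
  have pu: "norm (p * u) \<le> U"
  proof -
    have "norm p * norm u \<le> 1 * U" using p u by (intro mult_mono) auto
    thus ?thesis by (simp add: norm_mult)
  qed
  have apu: "norm (a * p * u) < 1"
    using mult_left_mono[OF u, of "norm (a * p)"] U(2) by (simp add: norm_mult)
  define X where "X = (1 - a * p * u) * (1 - a * p * u / (b * c))"
  define Y where "Y = (1 - a * p * u / b) * (1 - a * p * u / c)"
  define R where "R = (\<lambda>n. - (1 - a * p * u) * u * (a * p / (b * c)) *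
     (well_poised_coeff a b c p n * (\<Prod>j<n. u - p ^ j) / qpoch (a * p * u) p n) *
     ((1 - a * p ^ n) * (1 - b * p ^ n) * (1 - c * p ^ n) / (1 - a * p * u * p ^ n)))"
  have tel: "(\<Sum>k\<le>n. X * rogers_term a b c p u k - Y * rogers_term a b c p (p * u) k) = R n" for n
    using rogers_telescoping[OF p nz lt apu, of n] unfolding X_def Y_def R_def
    by (simp add: qpoch_Suc times_divide_times_eq mult_ac)
  have "R \<longlonglongrightarrow> - (1 - a * p * u) * u * (a * p / (b * c)) * 0 *
         ((1 - a * 0) * (1 - b * 0) * (1 - c * 0) / (1 - a * p * u * 0))"
    unfolding R_def
  proof (intro tendsto_intros LIMSEQ_power_zero)
    show "(\<lambda>n. well_poised_coeff a b c p n * (\<Prod>j<n. u - p ^ j) / qpoch (a * p * u) p n) \<longlonglongrightarrow> 0"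
    proof (rule Lim_null_comparison)
      show "(\<lambda>n. D * g ^ n) \<longlonglongrightarrow> 0"
        using g by (intro tendsto_mult_right_zero LIMSEQ_power_zero) auto
    qed (use D[OF u] in auto)
  qed (use p in auto)
  hence "R \<longlonglongrightarrow> 0" by simp
  moreover have "(\<lambda>n. \<Sum>k\<le>n. X * rogers_term a b c p u k - Y * rogers_term a b c p (p * u) k)
      \<longlonglongrightarrow> X * (\<Sum>k. rogers_term a b c p u k) - Y * (\<Sum>k. rogers_term a b c p (p * u) k)"
    using summ[OF u] summ[OF pu]
    by (intro sums_diff sums_mult summable_sums iffD1[OF sums_def_le])
  ultimately have "X * (\<Sum>k. rogers_term a b c p u k) - Y * (\<Sum>k. rogers_term a b c p (p * u) k) = 0"
    unfolding tel by (blast intro: LIMSEQ_unique)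
  thus ?thesis by (simp add: X_def Y_def)
qed

lemma rogers_iterate:
  assumes p: "norm p < 1" and nz: "b \<noteq> 0" "c \<noteq> 0"
    and lt: "norm (a * p / b) < 1" "norm (a * p / c) < 1"
    and U: "0 < U" "norm (a * p) * U < 1" "norm (a * p / (b * c)) * U < 1"
    and u: "norm u \<le> U"
  shows "qpoch (a * p * u) p n * qpoch (a * p * u / (b * c)) p n * (\<Sum>k. rogers_term a b c p u k)
       = qpoch (a * p * u / b) p n * qpoch (a * p * u / c) p n * (\<Sum>k. rogers_term a b c p (p ^ n * u) k)"
proof (induction n)
  case (Suc n)
  have "norm (p ^ n) * norm u \<le> 1 * U"
    using p u by (intro mult_mono) (auto simp: norm_power power_le_one)
  hence "norm (p ^ n * u) \<le> U" by (simp add: norm_mult)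
  note step = rogers_contiguous[OF p nz lt U this]
  define S where "S = (\<lambda>m. \<Sum>k. rogers_term a b c p (p ^ m * u) k)"
  define X where "X = qpoch (a * p * u) p n * qpoch (a * p * u / (b * c)) p n"
  define Y where "Y = qpoch (a * p * u / b) p n * qpoch (a * p * u / c) p n"
  define x where "x = (1 - a * p * (p ^ n * u)) * (1 - a * p * (p ^ n * u) / (b * c))"
  define y where "y = (1 - a * p * (p ^ n * u) / b) * (1 - a * p * (p ^ n * u) / c)"
  have "x * S n = y * S (Suc n)" "X * S 0 = Y * S n"
    using step Suc.IH by (simp_all add: S_def X_def Y_def x_def y_def mult_ac)
  hence "X * x * S 0 = Y * y * S (Suc n)" by algebra
  thus ?case by (simp add: qpoch_Suc S_def X_def Y_def x_def y_def mult_ac)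
qed simp

text \<open>Iterating \<open>u \<mapsto> p u\<close> drives the parameter to \<open>0\<close> and leaves a sum that does not depend on \<open>u\<close>.
  The unknown constant is then determined by any value of \<open>u\<close> at which the sum is known.\<close>

lemma rogers_limit:
  assumes p: "norm p < 1" and nz: "b \<noteq> 0" "c \<noteq> 0"
    and lt: "norm (a * p / b) < 1" "norm (a * p / c) < 1"
    and U: "0 < U" "norm (a * p) * U < 1" "norm (a * p / (b * c)) * U < 1"
    and u: "norm u \<le> U"
  shows "qpoch_inf (a * p * u) p * qpoch_inf (a * p * u / (b * c)) p * (\<Sum>k. rogers_term a b c p u k)
       = qpoch_inf (a * p * u / b) p * qpoch_inf (a * p * u / c) p * (\<Sum>k. rogers_term a b c p 0 k)"
proof -
  define g where "g = norm (a * p / (b * c)) * U"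
  obtain C where C: "\<And>u k. norm u \<le> U \<Longrightarrow> norm (rogers_term a b c p u k) \<le> C * g ^ k"
    using norm_rogers_term_le[OF p lt U(1,2)] unfolding g_def by metis
  have g: "norm g < 1" "0 \<le> g" using U by (simp_all add: g_def norm_mult)
  have pu: "norm (p ^ n * u) \<le> U" for n
  proof -
    have "norm (p ^ n) * norm u \<le> 1 * U"
      using p u by (intro mult_mono) (auto simp: norm_power power_le_one)
    thus ?thesis by (simp add: norm_mult)
  qed
  have "(\<lambda>n. \<Sum>k. rogers_term a b c p (p ^ n * u) k) \<longlonglongrightarrow> (\<Sum>k. rogers_term a b c p 0 k)"
  proof -
    have "(\<lambda>n. rogers_term a b c p (p ^ n * u) k) \<longlonglongrightarrow> rogers_term a b c p (0 * u) k" for k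
      unfolding rogers_term_def qpoch_def
      by (intro tendsto_intros LIMSEQ_power_zero p) auto
    moreover have "\<forall>\<^sub>F (k, n) in sequentially \<times>\<^sub>F sequentially.
        norm (rogers_term a b c p (p ^ n * u) k) \<le> C * g ^ k"
      using C[OF pu] by (intro always_eventually) auto
    moreover have "summable (\<lambda>k. C * g ^ k)" using g by (intro summable_mult summable_geometric)
    ultimately show ?thesis
      using tannerys_theorem[of "\<lambda>k n. rogers_term a b c p (p ^ n * u) k" "rogers_term a b c p 0"
              sequentially "\<lambda>k. C * g ^ k"] by simp
  qed
  hence "(\<lambda>n. qpoch (a * p * u / b) p n * qpoch (a * p * u / c) p n
      * (\<Sum>k. rogers_term a b c p (p ^ n * u) k))
     \<longlonglongrightarrow> qpoch_inf (a * p * u / b) p * qpoch_inf (a * p * u / c) p * (\<Sum>k. rogers_term a b c p 0 k)"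
    by (intro tendsto_intros qpoch_tendsto p)
  moreover have "(\<lambda>n. qpoch (a * p * u) p n * qpoch (a * p * u / (b * c)) p n
      * (\<Sum>k. rogers_term a b c p u k))
     \<longlonglongrightarrow> qpoch_inf (a * p * u) p * qpoch_inf (a * p * u / (b * c)) p * (\<Sum>k. rogers_term a b c p u k)"
    by (intro tendsto_intros qpoch_tendsto p)
  ultimately show ?thesis
    unfolding rogers_iterate[OF assms] by (blast intro: LIMSEQ_unique)
qed

text \<open>Rogers' nonterminating very-well-poised \<open>6\<phi>5\<close> sum. For \<open>u = 1\<close>, that is \<open>d = 1\<close>, the series
  reduces to its first term; comparing this with the limit \<open>u \<rightarrow> 0\<close> evaluates the sum for every
  admissible \<open>u\<close>.\<close>

theorem rogers_sum:
  assumes p: "norm p < 1" and nz: "b \<noteq> 0" "c \<noteq> 0"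
    and lt: "norm (a * p / b) < 1" "norm (a * p / c) < 1"
    and 1: "norm (a * p) < 1" "norm (a * p / (b * c)) < 1"
    and u: "norm (a * p * u) < 1" "norm (a * p * u / (b * c)) < 1"
  shows "rogers_term a b c p u sums
     ((1 - a) * (qpoch_inf (a * p) p * qpoch_inf (a * p / (b * c)) p *
                 qpoch_inf (a * p * u / b) p * qpoch_inf (a * p * u / c) p) /
      (qpoch_inf (a * p / b) p * qpoch_inf (a * p / c) p *
       qpoch_inf (a * p * u) p * qpoch_inf (a * p * u / (b * c)) p))"
proof -
  define U where "U = max 1 (norm u)"
  have U: "0 < U" "norm (a * p) * U < 1" "norm (a * p / (b * c))
      * U < 1" "norm u \<le> U" "norm (1::complex) \<le> U"
    using 1 u by (auto simp: U_def max_def norm_mult norm_divide)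
  obtain C where C: "\<And>u k. norm u \<le> U \<Longrightarrow>
      norm (rogers_term a b c p u k) \<le> C * (norm (a * p / (b * c)) * U) ^ k"
    using norm_rogers_term_le[OF p lt U(1,2)] by metis
  have summ: "summable (rogers_term a b c p u)"
    by (rule summable_comparison_test'[of "\<lambda>k. C * (norm (a * p / (b * c)) * U) ^ k" 0])
       (use C[OF U(4)] U in \<open>auto intro!: summable_mult summable_geometric simp: norm_mult norm_divide\<close>)
  \<comment> \<open>At \<open>u = 1\<close> every term but the first contains the factor \<open>u - p\<^sup>0 = 0\<close>.\<close>
  have "rogers_term a b c p 1 k = (if k = 0 then 1 - a else 0)" for k
    by (cases k) (simp_all add: rogers_term_def well_poised_coeff_def prod.lessThan_Suc_shift del: prod.lessThan_Suc)
  hence at1: "(\<Sum>k. rogers_term a b c p 1 k) = 1 - a"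
    using sums_unique[OF sums_single[of 0 "\<lambda>_. 1 - a"]] by simp
  have nz1: "qpoch_inf (a * p / b) p \<noteq> 0" "qpoch_inf (a * p / c) p \<noteq> 0"
     "qpoch_inf (a * p * u) p \<noteq> 0" "qpoch_inf (a * p * u / (b * c)) p \<noteq> 0"
    by (intro qpoch_inf_nonzero lt u p)+
  have at0: "(\<Sum>k. rogers_term a b c p 0 k) = (1 - a) * (qpoch_inf (a * p) p * qpoch_inf (a * p
      / (b * c)) p)
     / (qpoch_inf (a * p / b) p * qpoch_inf (a * p / c) p)"
    using rogers_limit[OF p nz lt U(1-3,5)] nz1 at1 by (simp add: field_simps)
  have "(\<Sum>k. rogers_term a b c p u k) = 
     ((1 - a) * (qpoch_inf (a * p) p * qpoch_inf (a * p / (b * c)) p *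
                 qpoch_inf (a * p * u / b) p * qpoch_inf (a * p * u / c) p) /
      (qpoch_inf (a * p / b) p * qpoch_inf (a * p / c) p *
       qpoch_inf (a * p * u) p * qpoch_inf (a * p * u / (b * c)) p))"
  proof -
    have alg: "s = (1 - a) * (X * Y * K * L) / (A * B * M * N)"
      if "s0 = (1 - a) * (X * Y) / (A * B)" "M * N * s = K * L * s0"
         "A \<noteq> 0" "B \<noteq> 0" "M \<noteq> 0" "N \<noteq> 0" for s s0 X Y K L A B M N :: complex
    proof -
      have "s = K * L * s0 / (M * N)" using that(2,5,6) by (simp add: field_simps)
      thus ?thesis by (simp add: that(1) mult_ac)
    qed
    show ?thesis by (rule alg[OF at0 rogers_limit[OF p nz lt U(1-4)] nz1])
  qed
  with summ show ?thesis by (metis summable_sums)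
qed

section \<open>Integrals over circles and a contiguous relation\<close>

definition circle_integral :: "real \<Rightarrow> (complex \<Rightarrow> complex) \<Rightarrow> complex" where
  "circle_integral R f = integral {- pi..pi} (\<lambda>\<psi>. f (of_real R * cis \<psi>))"

lemma contour_integral_circle_over_id:
  assumes "R > 0"
  shows "contour_integral (part_circlepath 0 R (- pi) pi) (\<lambda>z. G z / z)
           = \<i> * circle_integral R G"
proof -
  have "contour_integral (part_circlepath 0 R (- pi) pi) (\<lambda>z. G z / z) =
          integral {- pi..pi} (\<lambda>\<psi>. \<i> * G (of_real R * cis \<psi>))"
    by (subst contour_integral_part_circlepath_eq)
       (use assms in \<open>auto intro!: integral_cong\<close>)
  thus ?thesis by (simp add: circle_integral_def)
qed

text \<open>The spiral \<open>s \<mapsto> exp (s Ln c)\<close> leads from \<open>1\<close> to \<open>c\<close> with modulus between \<open>norm c\<close> and \<open>1\<close>, so it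
  deforms the circle into its image under \<open>z \<mapsto> c z\<close> inside the annulus. Cauchy's theorem for
  \<open>G z / z\<close> then gives the claim; the measure \<open>dz / (\<i> z)\<close> is the arc length \<open>d\<psi>\<close>.\<close>

lemma circle_integral_scale:
  fixes G :: "complex \<Rightarrow> complex" and c :: complex
  assumes R: "R > 0" and c: "c \<noteq> 0" "norm c \<le> 1"
    and S: "open S" "\<And>z. \<lbrakk>norm c * R \<le> norm z; norm z \<le> R\<rbrakk> \<Longrightarrow> z \<in> S"
    and hol: "G holomorphic_on S"
  shows "circle_integral R (\<lambda>z. G (c * z)) = circle_integral R G"
proof -
  define \<gamma> where "\<gamma> = part_circlepath 0 R (- pi) pi"
  have norm_\<gamma>: "norm (\<gamma> x) = R" for x
    using R by (simp add: \<gamma>_def part_circlepath_def norm_mult of_real_linepath [symmetric])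
  have loop: "\<gamma> 1 = \<gamma> 0"
    by (simp add: \<gamma>_def part_circlepath_def linepath_def exp_minus)
  have hom: "homotopic_loops (S - {0}) \<gamma> ((\<lambda>z. c * z) \<circ> \<gamma>)"
    unfolding homotopic_loops
  proof (intro exI conjI ballI)
    let ?h = "\<lambda>(s, x). exp (of_real s * Ln c) * \<gamma> x"
    show "continuous_on ({0..1::real} \<times> {0..1}) ?h"
      unfolding \<gamma>_def part_circlepath_def linepath_def case_prod_unfold
      by (intro continuous_intros)
    show "?h \<in> ({0..1} \<times> {0..1}) \<rightarrow> S - {0}"
    proof (rule Pi_I, clarify)
      fix s x :: real assume s: "s \<in> {0..1}"
      have nc: "norm c = exp (ln (norm c))" using c by simp
      have l: "ln (norm c) \<le> 0" using c by simp
      have n: "norm (exp (of_real s * Ln c) * \<gamma> x) = exp (s * ln (norm c)) * R"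
        using c by (simp add: norm_mult norm_\<gamma>)
      have "1 * ln (norm c) \<le> s * ln (norm c)"
        using s l by (intro mult_right_mono_neg) auto
      hence "norm c \<le> exp (s * ln (norm c))" by (subst nc) simp
      moreover have "exp (s * ln (norm c)) \<le> 1"
        using s l by (simp add: mult_nonneg_nonpos)
      ultimately have "exp (of_real s * Ln c) * \<gamma> x \<in> S"
        using R by (intro S(2)) (auto simp: n)
      moreover have "\<gamma> x \<noteq> 0" using norm_\<gamma>[of x] R by auto
      ultimately show "exp (of_real s * Ln c) * \<gamma> x \<in> S - {0}" by simp
    qed
    show "?h (0, x) = \<gamma> x" for x by simp
    show "?h (1, x) = ((\<lambda>z. c * z) \<circ> \<gamma>) x" for x using c by simp
    show "pathfinish (?h \<circ> Pair t) = pathstart (?h \<circ> Pair t)" for t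
      by (simp add: pathfinish_def pathstart_def loop)
  qed
  have vp: "valid_path \<gamma>" by (simp add: \<gamma>_def)
  have "contour_integral \<gamma> (\<lambda>z. G z / z) = contour_integral ((\<lambda>z. c * z) \<circ> \<gamma>) (\<lambda>z. G z / z)"
  proof (rule Cauchy_theorem_homotopic_loops[OF hom])
    show "open (S - {0})" using S by auto
    show "(\<lambda>z. G z / z) holomorphic_on S - {0}"
      by (intro holomorphic_intros holomorphic_on_subset[OF hol]) auto
    show "valid_path ((\<lambda>z. c * z) \<circ> \<gamma>)"
      by (rule valid_path_compose_holomorphic[OF vp, of _ UNIV]) (auto intro!: holomorphic_intros)
  qed (fact vp)
  also have "\<dots> = contour_integral \<gamma> (\<lambda>w. deriv (\<lambda>z. c * z) w * (G (c * w) / (c * w)))"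
    by (rule contour_integral_comp_analyticW[of _ UNIV])
       (use vp in \<open>auto intro!: analytic_intros\<close>)
  also have "(\<lambda>w. deriv (\<lambda>z. c * z) w * (G (c * w) / (c * w))) = (\<lambda>w. G (c * w) / w)"
    using c by (auto simp: fun_eq_iff deriv_linear)
  finally show ?thesis
    unfolding \<gamma>_def using contour_integral_circle_over_id[OF R] by simp
qed

text \<open>With \<open>e = r1 r2\<close>, the integrands considered here contain the product of the theta functions
  with arguments \<open>H / z\<close> and \<open>H z / e\<close>. This is the part of such an integrand that depends on
  \<open>1 / z\<close>: it is analytic at infinity, and its poles \<open>r1 q\<^sup>j\<close>, \<open>r2 q\<^sup>j\<close> lie inside the circle.
  The remaining factors depend on \<open>z\<close>.\<close>

definition theta_ratio :: "complex \<Rightarrow> complex \<Rightarrow> complex \<Rightarrow> complex \<Rightarrow> complex \<Rightarrow> complex" where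
  "theta_ratio H r1 r2 q z =
     qpoch_inf (H / z) q * qpoch_inf (q * (r1 * r2) / (H * z)) q /
     (qpoch_inf (r1 / z) q * qpoch_inf (r2 / z) q)"

lemma continuous_on_theta_ratio [continuous_intros]:
  assumes "norm q < 1" "continuous_on X f" "H \<noteq> 0"
    "\<And>x. x \<in> X \<Longrightarrow> norm r1 < norm (f x)" "\<And>x. x \<in> X \<Longrightarrow> norm r2 < norm (f x)"
  shows   "continuous_on X (\<lambda>x. theta_ratio H r1 r2 q (f x))"
  unfolding theta_ratio_def
proof -
  have nz: "f x \<noteq> 0" if "x \<in> X" for x using assms(4)[OF that] by auto
  have "qpoch_inf (r1 / f x) q \<noteq> 0" "qpoch_inf (r2 / f x) q \<noteq> 0" if x: "x \<in> X" for x
    by (intro qpoch_inf_nonzero assms(1); use assms(4,5)[OF x] nz[OF x] in \<open>simp add: norm_divide\<close>)+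
  thus "continuous_on X (\<lambda>x. qpoch_inf (H / f x) q * qpoch_inf (q * (r1 * r2) / (H * f x)) q /
          (qpoch_inf (r1 / f x) q * qpoch_inf (r2 / f x) q))"
    using nz assms(3) by (intro continuous_intros assms(1,2)) auto
qed

lemma integrable_circle:
  fixes F :: "complex \<Rightarrow> complex"
  assumes "R > 0" "continuous_on (sphere 0 R) F"
  shows   "(\<lambda>\<psi>. F (of_real R * cis \<psi>)) integrable_on {- pi..pi}"
  by (intro integrable_continuous_interval continuous_on_compose2[OF assms(2)] continuous_intros)
     (use assms(1) in \<open>auto simp: norm_mult\<close>)

text \<open>The relation between the integrals with parameter \<open>A\<close> and with \<open>q A\<close>. The combination of the
  two integrands is a difference \<open>G z - G (q z)\<close>, and \<open>G\<close> has no pole in the annulus between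
  the circle and its image under multiplication by \<open>q\<close>, because it contains \<open>q r1\<close> and \<open>q r2\<close>
  where the integrand contains \<open>r1\<close> and \<open>r2\<close>. The function \<open>U\<close> stands for the part of the
  integrand depending on \<open>z\<close>; only its behaviour under \<open>z \<mapsto> q z\<close> matters, so that the same
  lemma applies to polynomials and to quotients of infinite products.\<close>

lemma circle_integral_contiguous:
  fixes q H r1 r2 A B C :: complex and U :: "complex \<Rightarrow> complex"
  defines "e \<equiv> r1 * r2"
  assumes q: "q \<noteq> 0" "norm q < 1" and H: "H \<noteq> 0" and r: "r1 \<noteq> 0" "r2 \<noteq> 0"
    and R: "norm r1 < R" "norm r2 < R"
    and S: "open S" "\<And>z. \<lbrakk>norm q * R \<le> norm z; norm z \<le> R\<rbrakk> \<Longrightarrow> z \<in> S"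
    and hol: "U holomorphic_on S"
    and func: "\<And>z. norm z = R \<Longrightarrow>
        U (q * z) * (1 - H / e * z) * (1 - q / H * z) * (1 - q * (e * A * B * C) * z)
          = U z * (1 - A * z) * (1 - B * z) * (1 - C * z)"
  shows "(1 - A * r1) * (1 - A * r2) * circle_integral R (\<lambda>z. (1 - e * A * B * C * z) * U z
      * theta_ratio H r1 r2 q z)
       = (1 - e * A * B) * (1 - e * A * C) * circle_integral R (\<lambda>z. (1 - A * z) * U z
           * theta_ratio H r1 r2 q z)"
proof -
  have R0: "R > 0" using R(1) norm_ge_zero[of r1] by linarith
  have e: "e \<noteq> 0" using r by (simp add: e_def)
  define G where "G = (\<lambda>z. A * z * (1 - e * A * B * C * z) * U z *
     (qpoch_inf (H / z) q * qpoch_inf (q * e / (H * z)) q /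
      (qpoch_inf (q * r1 / z) q * qpoch_inf (q * r2 / z) q)))"
  define T where "T = theta_ratio H r1 r2 q"
  define S' where "S' = S \<inter> {z. norm (q * r1) < norm z} \<inter> {z. norm (q * r2) < norm z}"
  have S': "open S'" unfolding S'_def
    by (intro open_Int S(1) open_Collect_less continuous_intros)
  have S'2: "z \<in> S'" if "norm q * R \<le> norm z" "norm z \<le> R" for z
  proof -
    have "norm q * norm r1 < norm q * R" "norm q * norm r2 < norm q * R" using R q by auto
    hence "norm q * norm r1 < norm z" "norm q * norm r2 < norm z" using that by linarith+
    thus ?thesis using S(2)[OF that] by (auto simp: S'_def norm_mult)
  qed
  have S'0: "z \<noteq> 0" if "z \<in> S'" for z using that by (auto simp: S'_def)
  have holG: "G holomorphic_on S'"
    unfolding G_def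
  proof (intro holomorphic_intros q holomorphic_on_subset[OF hol])
    show "S' \<subseteq> S" by (auto simp: S'_def)
    fix z assume z: "z \<in> S'"
    hence nz: "z \<noteq> 0" using norm_ge_zero[of "q * r1"] by (auto simp: S'_def)
    thus "z \<noteq> 0" "H * z \<noteq> 0" using H by auto
    have "qpoch_inf (q * r1 / z) q \<noteq> 0" "qpoch_inf (q * r2 / z) q \<noteq> 0"
      by (intro qpoch_inf_nonzero q; use z nz in \<open>simp add: S'_def norm_divide\<close>)+
    thus "qpoch_inf (q * r1 / z) q * qpoch_inf (q * r2 / z) q \<noteq> 0" by simp
  qed (use S'0 in auto)
  have GG: "G z - G (q * z) = (1 - A * r1) * (1 - A * r2) * ((1 - e * A * B * C * z) * U z * T z)
         - (1 - e * A * B) * (1 - e * A * C) * ((1 - A * z) * U z * T z)" if z: "norm z = R" for z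
  proof -
    have z0: "z \<noteq> 0" using z R0 by auto
    define N where "N = qpoch_inf (H / z) q * qpoch_inf (q * e / (H * z)) q"
    define D1 where "D1 = qpoch_inf (q * r1 / z) q"
    define D2 where "D2 = qpoch_inf (q * r2 / z) q"
    have D: "qpoch_inf (r1 / z) q = (1 - r1 / z) * D1" "qpoch_inf (r2 / z) q = (1 - r2 / z) * D2"
      using qpoch_inf_step[OF q(2), of "r1 / z"] qpoch_inf_step[OF q(2), of "r2 / z"]
      by (simp_all add: D1_def D2_def mult_ac)
    have ne: "r1 \<noteq> z" "r2 \<noteq> z" using z R by auto
    hence Dnz: "(1 - r1 / z) \<noteq> 0" "(1 - r2 / z) \<noteq> 0" using z0 by auto
    have cancel_factors: "s * t * (n / (s * d1 * (t * d2))) = n / (d1 * d2)"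
      if "s \<noteq> 0" "t \<noteq> 0" for s t n d1 d2 :: complex
      using that by (simp add: field_simps)
    have T: "N / (D1 * D2) = (1 - r1 / z) * (1 - r2 / z) * T z"
      unfolding T_def theta_ratio_def D e_def [symmetric] N_def by (rule cancel_factors[OF Dnz, symmetric])
    have Nq: "qpoch_inf (H / (q * z)) q * qpoch_inf (q * e / (H * (q * z))) q
              = (1 - H / (q * z)) * (1 - e / (H * z)) * N"
      using qpoch_inf_step[OF q(2), of "H / (q * z)"] qpoch_inf_step[OF q(2), of "e / (H * z)"] q
      by (simp add: N_def mult_ac)
    have DD: "qpoch_inf (q * r1 / (q * z)) q * qpoch_inf (q * r2 / (q * z)) q =
        qpoch_inf (r1 / z) q * qpoch_inf (r2 / z) q"
      using q by simp
    have "G (q * z) = A * (q * z) * (1 - q * (e * A * B * C) * z) * U (q * z) *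
        ((1 - H / (q * z)) * (1 - e / (H * z)) * T z)"
      unfolding G_def Nq DD by (simp add: T_def theta_ratio_def N_def e_def mult_ac)
    also have "\<dots> = A * (1 - q * (e * A * B * C) * z) * U (q * z) * T z *
         ((q * z) * (1 - H / (q * z)) * (1 - e / (H * z)))"
      by (simp add: mult_ac)
    also have "(q * z) * (1 - H / (q * z)) * (1 - e / (H * z)) =
        e / z * ((1 - H / e * z) * (1 - q / H * z))"
      using q H z0 e by (simp add: field_simps)
    also have "A * (1 - q * (e * A * B * C) * z) * U (q * z) * T z *
          (e / z * ((1 - H / e * z) * (1 - q / H * z))) =
        A * (e / z) * T z * (U (q * z) * (1 - H / e * z) * (1 - q / H * z) * (1 - q * (e * A * B
            * C) * z))"
      by (simp add: mult_ac)
    also have "\<dots> = A * (e / z) * T z * (U z * (1 - A * z) * (1 - B * z) * (1 - C * z))"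
      by (subst func[OF z]) simp
    finally have 1: "G (q * z) = A * (e / z) * T z * (U z * (1 - A * z) * (1 - B * z) * (1 - C * z))" .
    have 2: "G z = A * z * (1 - e * A * B * C * z) * U z * ((1 - r1 / z) * (1 - r2 / z) * T z)"
      unfolding G_def using T by (simp add: N_def D1_def D2_def)
    have 3: "A * z * (1 - e * A * B * C * z) * ((1 - r1 / z) * (1 - r2 / z))
          - A * (e / z) * ((1 - A * z) * (1 - B * z) * (1 - C * z))
       = (1 - A * r1) * (1 - A * r2) * (1 - e * A * B * C * z)
         - (1 - e * A * B) * (1 - e * A * C) * (1 - A * z)"
      unfolding e_def using z0 by (simp add: divide_simps) algebra
    have "G z - G (q * z) = U z * T z * (A * z * (1 - e * A * B * C * z) * ((1 - r1 / z) * (1 - r2 / z))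
          - A * (e / z) * ((1 - A * z) * (1 - B * z) * (1 - C * z)))"
      unfolding 1 2 by (simp add: algebra_simps)
    thus ?thesis unfolding 3 by (simp add: algebra_simps)
  qed
  have circ: "norm (of_real R * cis \<psi>) = R" for \<psi> using R0 by (simp add: norm_mult)
  have sph: "sphere 0 R \<subseteq> S" using S(2) q R0 by (auto simp: mult_le_cancel_right1)
  have contU: "continuous_on (sphere 0 R) U"
    using holomorphic_on_imp_continuous_on[OF hol] sph by (rule continuous_on_subset)
  have contT: "continuous_on (sphere 0 R) T" unfolding T_def
    by (intro continuous_intros q H) (use R in auto)
  have int1: "(\<lambda>\<psi>. (\<lambda>z. (1 - e * A * B * C * z) * U z * T z) (of_real R
      * cis \<psi>)) integrable_on {- pi..pi}"
    by (intro integrable_circle continuous_intros contU contT R0)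
  have int2: "(\<lambda>\<psi>. (\<lambda>z. (1 - A * z) * U z * T z) (of_real R * cis \<psi>)) integrable_on {- pi..pi}"
    by (intro integrable_circle continuous_intros contU contT R0)
  have contG: "continuous_on S' G" by (rule holomorphic_on_imp_continuous_on[OF holG])
  have inS': "of_real R * cis \<psi> \<in> S'" "q * (of_real R * cis \<psi>) \<in> S'" for \<psi>
    using q R0 by (auto intro!: S'2 simp: norm_mult mult_le_cancel_right1 mult_le_cancel_right2)
  have int3: "(\<lambda>\<psi>. G (of_real R * cis \<psi>)) integrable_on {- pi..pi}"
    by (intro integrable_continuous_interval continuous_on_compose2[OF contG] continuous_intros)
       (use inS' in auto)
  have int4: "(\<lambda>\<psi>. G (q * (of_real R * cis \<psi>))) integrable_on {- pi..pi}"
    by (intro integrable_continuous_interval continuous_on_compose2[OF contG] continuous_intros)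
       (use inS' in auto)
  have "integral {- pi..pi} (\<lambda>\<psi>. G (of_real R * cis \<psi>) - G (q * (of_real R * cis \<psi>))) = 0"
    using circle_integral_scale[OF R0 q(1) _ S' S'2 holG, unfolded circle_integral_def] q int3 int4
    by (simp add: Henstock_Kurzweil_Integration.integral_diff)
  also have "(\<lambda>\<psi>. G (of_real R * cis \<psi>) - G (q * (of_real R * cis \<psi>))) =
     (\<lambda>\<psi>. (1 - A * r1) * (1 - A * r2) * (\<lambda>z. (1 - e * A * B * C * z) * U z * T z) (of_real R * cis \<psi>)
         - (1 - e * A * B) * (1 - e * A * C) * (\<lambda>z. (1 - A * z) * U z * T z) (of_real R * cis \<psi>))"
    by (intro ext) (simp only: GG[OF circ])
  also have "integral {- pi..pi} \<dots> =
       (1 - A * r1) * (1 - A * r2) * circle_integral R (\<lambda>z. (1 - e * A * B * C * z) * U z * T z)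
     - (1 - e * A * B) * (1 - e * A * C) * circle_integral R (\<lambda>z. (1 - A * z) * U z * T z)"
    unfolding circle_integral_def
    by (subst Henstock_Kurzweil_Integration.integral_diff)
       (use int1 int2 in \<open>auto intro!: integrable_on_mult_right\<close>)
  finally show ?thesis by (simp add: T_def)
qed

section \<open>The nonterminating Saalschuetz sum as an integral\<close>

lemma circle_integral_cong:
  assumes "R > 0" "\<And>z. norm z = R \<Longrightarrow> F z = G z"
  shows   "circle_integral R F = circle_integral R G"
  unfolding circle_integral_def using assms by (intro integral_cong) (auto simp: norm_mult)

lemma circle_integral_tendsto:
  fixes F :: "nat \<Rightarrow> complex \<Rightarrow> complex"
  assumes R: "R > 0" and cont: "\<And>n. continuous_on (sphere 0 R) (F n)"
    and bound: "\<And>n z. norm z = R \<Longrightarrow> norm (F n z) \<le> C"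
    and lim: "\<And>z. norm z = R \<Longrightarrow> (\<lambda>n. F n z) \<longlonglongrightarrow> G z"
  shows   "(\<lambda>n. circle_integral R (F n)) \<longlonglongrightarrow> circle_integral R G"
  unfolding circle_integral_def
  by (rule dominated_convergence[of _ _ "\<lambda>_. C"])
     (use R in \<open>auto intro!: integrable_circle cont bound lim simp: norm_mult\<close>)

lemma circle_integral_tendsto_weighted:
  fixes F :: "nat \<Rightarrow> complex \<Rightarrow> complex"
  assumes R: "R > 0" and cont: "\<And>n. continuous_on (sphere 0 R) (F n)" "continuous_on (sphere 0 R) T"
    and bound: "\<And>n z. norm z = R \<Longrightarrow> norm (F n z) \<le> C"
    and lim: "\<And>z. norm z = R \<Longrightarrow> (\<lambda>n. F n z) \<longlonglongrightarrow> G z"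
  shows   "(\<lambda>n. circle_integral R (\<lambda>z. F n z * T z)) \<longlonglongrightarrow> circle_integral R (\<lambda>z. G z * T z)"
proof -
  have "compact (T ` sphere 0 R)"
    using cont(2) by (intro compact_continuous_image) auto
  then obtain D where D: "\<And>z. norm z = R \<Longrightarrow> norm (T z) \<le> D"
    using compact_imp_bounded[of "T ` sphere 0 R"] unfolding bounded_iff by force
  show ?thesis
  proof (rule circle_integral_tendsto[where C = "C * D"])
    fix n z assume z: "norm (z :: complex) = R"
    show "norm (F n z * T z) \<le> C * D"
      unfolding norm_mult using bound[OF z, of n] D[OF z] order_trans[OF norm_ge_zero bound[OF z, of n]]
      by (intro mult_mono) auto
    show "(\<lambda>n. F n z * T z) \<longlonglongrightarrow> G z * T z"
      by (intro tendsto_intros lim z)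
  qed (intro continuous_intros cont R)+
qed

text \<open>The integral does not change when the circle is shrunk to the origin.\<close>

lemma circle_integral_mean_value:
  assumes R: "R > 0" and S: "open S" "cball 0 R \<subseteq> S" and hol: "W holomorphic_on S"
  shows   "circle_integral R W = 2 * of_real pi * W 0"
proof -
  define c where "c = (\<lambda>n::nat. (1 / 2) ^ n :: complex)"
  have c: "c n \<noteq> 0" "norm (c n) \<le> 1" for n
    by (auto simp: c_def norm_power norm_divide power_le_one)
  have eq: "circle_integral R (\<lambda>z. W (c n * z)) = circle_integral R W" for n
    by (rule circle_integral_scale[OF R c S(1) _ hol]) (use S(2) in auto)
  have cont: "continuous_on (cball 0 R) W"
    using holomorphic_on_imp_continuous_on[OF hol] S(2) by (rule continuous_on_subset)
  have cz: "c n * z \<in> cball 0 R" if "norm z = R" for n z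
    using c(2)[of n] that R by (simp add: norm_mult mult_left_le_one_le)
  obtain D where D: "\<And>z. z \<in> cball 0 R \<Longrightarrow> norm (W z) \<le> D"
    using compact_imp_bounded[OF compact_continuous_image[OF cont compact_cball]]
    unfolding bounded_iff by blast
  have "(\<lambda>n. circle_integral R (\<lambda>z. W (c n * z))) \<longlonglongrightarrow> circle_integral R (\<lambda>z. W 0)"
  proof (rule circle_integral_tendsto[OF R])
    show "continuous_on (sphere 0 R) (\<lambda>z. W (c n * z))" for n
      by (intro continuous_on_compose2[OF cont] continuous_intros) (use cz in auto)
    fix z :: complex assume z: "norm z = R"
    show "norm (W (c n * z)) \<le> D" for n by (intro D cz z)
    have "0 \<in> S" using S(2) R by auto
    hence "isCont W 0"
      using holomorphic_on_imp_continuous_on[OF hol] S R by (auto simp: continuous_on_eq_continuous_at)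
    moreover have "(\<lambda>n. c n * z) \<longlonglongrightarrow> 0 * z"
      unfolding c_def by (intro tendsto_intros LIMSEQ_power_zero) (simp add: norm_divide)
    ultimately show "(\<lambda>n. W (c n * z)) \<longlonglongrightarrow> W 0"
      using isCont_tendsto_compose by fastforce
  qed
  hence "circle_integral R W = circle_integral R (\<lambda>z. W 0)"
    unfolding eq by (simp add: LIMSEQ_const_iff)
  thus ?thesis by (simp add: circle_integral_def scaleR_conv_of_real)
qed

lemma circle_integral_reciprocal:
  assumes "R > 0"
  shows   "circle_integral R (\<lambda>z. W (1 / z)) = circle_integral (1 / R) W"
proof -
  have "circle_integral R (\<lambda>z. W (1 / z)) = integral {- pi..pi} (\<lambda>\<psi>. W (of_real (1 / R) * cis (- \<psi>)))"
    unfolding circle_integral_def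
    unfolding cis_inverse [symmetric] by (intro integral_cong) (simp add: divide_inverse)
  also have "\<dots> = circle_integral (1 / R) W"
    unfolding circle_integral_def
    using Henstock_Kurzweil_Integration.integral_reflect_real
      [of pi "- pi" "\<lambda>\<psi>. W (of_real (1 / R) * cis \<psi>)"] by simp
  finally show ?thesis .
qed

lemma circle_integral_theta_ratio:
  assumes q: "norm q < 1" and R: "norm r1 < R" "norm r2 < R"
  shows   "circle_integral R (theta_ratio H r1 r2 q) = 2 * of_real pi"
proof -
  have R0: "R > 0" using R(1) norm_ge_zero[of r1] by linarith
  define W where "W = (\<lambda>x. qpoch_inf (H * x) q * qpoch_inf (q * (r1 * r2) / H * x) q /
     (qpoch_inf (r1 * x) q * qpoch_inf (r2 * x) q))"
  define S where "S = {x. norm (r1 * x) < 1} \<inter> {x. norm (r2 * x) < 1}"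
  have "theta_ratio H r1 r2 q = (\<lambda>z. W (1 / z))"
    by (simp add: theta_ratio_def W_def fun_eq_iff mult.commute)
  hence "circle_integral R (theta_ratio H r1 r2 q) = circle_integral (1 / R) W"
    using circle_integral_reciprocal[OF R0] by simp
  also have "\<dots> = 2 * of_real pi * W 0"
  proof (rule circle_integral_mean_value)
    show "open S" unfolding S_def by (intro open_Int open_Collect_less continuous_intros)
    show "cball 0 (1 / R) \<subseteq> S"
    proof
      fix x :: complex assume "x \<in> cball 0 (1 / R)"
      hence x: "norm x \<le> 1 / R" by simp
      have "norm (r * x) < 1" if "norm r < R" for r
      proof -
        have "norm r * norm x \<le> norm r * (1 / R)" using x by (intro mult_left_mono) auto
        also have "\<dots> < 1" using that R0 by simp
        finally show ?thesis by (simp add: norm_mult)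
      qed
      thus "x \<in> S" using R by (simp add: S_def)
    qed
    have "qpoch_inf (r1 * x) q * qpoch_inf (r2 * x) q \<noteq> 0" if "x \<in> S" for x
      using that q unfolding S_def by (simp add: qpoch_inf_nonzero)
    thus "W holomorphic_on S" unfolding W_def by (intro holomorphic_intros q) auto
  qed (use R0 in auto)
  finally show ?thesis by (simp add: W_def)
qed

lemma qpoch_scaled_argument: "qpoch (q * t) q m * (1 - t) = qpoch t q m * (1 - q ^ m * t)"
  using qpoch_Suc_shift[of t q m] by (simp add: qpoch_Suc mult_ac)

text \<open>The theta functions are truncated: of their factors depending on \<open>z\<close> only the first \<open>m\<close> are kept.
  For \<open>m = 0\<close> the integrand is a power series in \<open>1 / z\<close> with constant term \<open>1\<close>. Each
  further factor is attached with the contiguous relation, in which \<open>U\<close> is a polynomial,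
  so that no parameter has to be small.\<close>

lemma circle_integral_theta_truncated:
  fixes q H r1 r2 :: complex
  defines "e \<equiv> r1 * r2"
  assumes q: "q \<noteq> 0" "norm q < 1" and H: "H \<noteq> 0" and r: "r1 \<noteq> 0" "r2 \<noteq> 0"
    and R: "norm r1 < R" "norm r2 < R"
  shows "qpoch q q (2 * m) * circle_integral R (\<lambda>z. qpoch (H / e * z) q m * qpoch (q / H * z) q m
      * theta_ratio H r1 r2 q z)
      = 2 * of_real pi * (qpoch (H / r1) q m * qpoch (H / r2) q m * qpoch (q * r1 / H) q m
          * qpoch (q * r2 / H) q m)"
proof -
  define T where "T = theta_ratio H r1 r2 q"
  define K where "K = (\<lambda>m n. circle_integral R (\<lambda>z. qpoch (H / e * z) q m * qpoch (q / H * z) q n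
      * T z))"
  have e: "e \<noteq> 0" using r by (simp add: e_def)
  have e_simps: "H / e * t * r1 = H / r2 * t" "H / e * t * r2 = H / r1 * t" for t
    using r by (simp_all add: e_def)
  have eAB: "e * (H / e * q ^ m) * (q / H * q ^ n) = q * q ^ (m + n)" for m n
    using H e by (simp add: power_add)
  have func: "qpoch (H / e * (q * z)) q m * qpoch (q / H * (q * z)) q n * (1 - H / e * z) * (1 - q
      / H * z)
     = qpoch (H / e * z) q m * qpoch (q / H * z) q n * (1 - H / e * q ^ m * z) * (1 - q / H
         * q ^ n * z)" for m n z
    using qpoch_scaled_argument[of q "H / e * z" m] qpoch_scaled_argument[of q "q / H * z" n]
    by (simp add: mult_ac) algebra
  \<comment> \<open>\<open>A\<close> is chosen such that \<open>1 - A z\<close> is the next factor of the first product, and \<open>B\<close>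
      such that \<open>1 - B z\<close> is the next factor of the second one; then \<open>e A B = q\<^sup>m\<^sup>+\<^sup>n\<^sup>+\<^sup>1\<close>.\<close>
  have step1: "(1 - q * q ^ (m + n)) * K (Suc m) n = (1 - H / r2 * q ^ m) * (1 - H / r1 * q ^ m)
      * K m n" for m n
  proof -
    have "(1 - (H / e * q ^ m) * r1) * (1 - (H / e * q ^ m) * r2) *
        circle_integral R (\<lambda>z. (1 - r1 * r2 * (H / e * q ^ m) * (q / H * q ^ n) * 0 * z)
            * (qpoch (H / e * z) q m * qpoch (q / H * z) q n) * theta_ratio H r1 r2 q z)
      = (1 - r1 * r2 * (H / e * q ^ m) * (q / H * q ^ n)) * (1 - r1 * r2 * (H / e * q ^ m) * 0) *
        circle_integral R (\<lambda>z. (1 - H / e * q ^ m * z) * (qpoch (H / e * z) q m * qpoch (q / H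
            * z) q n) * theta_ratio H r1 r2 q z)"
      by (rule circle_integral_contiguous[OF q H r R open_UNIV])
         (use func in \<open>auto intro!: holomorphic_intros simp: e_def\<close>)
    thus ?thesis
      unfolding e_def [symmetric] eAB e_simps K_def T_def
      by (simp add: qpoch_Suc mult_ac)
  qed
  have step2: "(1 - q * q ^ (m + n)) * K m (Suc n) = (1 - q * r1 / H * q ^ n) * (1 - q * r2 / H
      * q ^ n) * K m n" for m n
  proof -
    have "(1 - (q / H * q ^ n) * r1) * (1 - (q / H * q ^ n) * r2) *
        circle_integral R (\<lambda>z. (1 - r1 * r2 * (q / H * q ^ n) * (H / e * q ^ m) * 0 * z)
            * (qpoch (H / e * z) q m * qpoch (q / H * z) q n) * theta_ratio H r1 r2 q z)
      = (1 - r1 * r2 * (q / H * q ^ n) * (H / e * q ^ m)) * (1 - r1 * r2 * (q / H * q ^ n) * 0) *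
        circle_integral R (\<lambda>z. (1 - q / H * q ^ n * z) * (qpoch (H / e * z) q m * qpoch (q / H
            * z) q n) * theta_ratio H r1 r2 q z)"
      by (rule circle_integral_contiguous[OF q H r R open_UNIV])
         (use func in \<open>auto intro!: holomorphic_intros simp: e_def mult_ac\<close>)
    moreover have "e * (q / H * q ^ n) * (H / e * q ^ m) = q * q ^ (m + n)"
      unfolding eAB[of m n, symmetric] by (simp only: mult_ac)
    ultimately show ?thesis
      unfolding e_def [symmetric] K_def T_def
      by (simp add: qpoch_Suc mult_ac)
  qed
  have "qpoch q q (2 * m) * K m m = 2 * of_real pi *
      (qpoch (H / r1) q m * qpoch (H / r2) q m * qpoch (q * r1 / H) q m * qpoch (q * r2 / H) q m)" for m
  proof (induction m)
    case 0
    show ?case using circle_integral_theta_ratio[OF q(2) R, of H] by (simp add: K_def T_def)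
  next
    case (Suc m)
    have "2 * Suc m = Suc (Suc (m + m))" by simp
    hence "qpoch q q (2 * Suc m) * K (Suc m) (Suc m) =
       qpoch q q (m + m) * (1 - q * q ^ (m + m)) * ((1 - q * q ^ (Suc m + m)) * K (Suc m) (Suc m))"
      by (simp only: qpoch_Suc) (simp add: mult_ac)
    also have "\<dots> = (1 - q * r1 / H * q ^ m) * (1 - q * r2 / H * q ^ m) *
         (qpoch q q (m + m) * ((1 - q * q ^ (m + m)) * K (Suc m) m))"
      unfolding step2 by (simp only: mult_ac)
    also have "\<dots> = (1 - q * r1 / H * q ^ m) * (1 - q * r2 / H * q ^ m) * (1 - H / r2 * q ^ m) * (1
        - H / r1 * q ^ m) *
         (qpoch q q (2 * m) * K m m)"
      unfolding step1 mult_2 by (simp only: mult_ac)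
    finally show ?case unfolding Suc.IH by (simp add: qpoch_Suc mult_ac)
  qed
  thus ?thesis by (simp add: K_def T_def)
qed

lemma circle_integral_theta:
  fixes q H r1 r2 :: complex
  assumes q: "q \<noteq> 0" "norm q < 1" and H: "H \<noteq> 0" and r: "r1 \<noteq> 0" "r2 \<noteq> 0"
    and R: "norm r1 < R" "norm r2 < R"
  shows "qpoch_inf q q * circle_integral R (\<lambda>z. qpoch_inf (H / (r1 * r2) * z) q * qpoch_inf (q / H
      * z) q * theta_ratio H r1 r2 q z)
      = 2 * of_real pi * (qtheta (H / r1) q * qtheta (H / r2) q)"
proof (rule LIMSEQ_unique)
  have R0: "R > 0" using R(1) norm_ge_zero[of r1] by linarith
  let ?K = "\<lambda>m. circle_integral R (\<lambda>z. qpoch (H / (r1 * r2) * z) q m * qpoch (q / H * z) q m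
      * theta_ratio H r1 r2 q z)"
  let ?P = "\<lambda>m. 2 * of_real pi * (qpoch (H / r1) q m * qpoch (H / r2) q m * qpoch (q * r1 / H) q m
      * qpoch (q * r2 / H) q m)"
  have "?K \<longlonglongrightarrow> circle_integral R (\<lambda>z. qpoch_inf (H / (r1 * r2) * z) q * qpoch_inf (q / H * z) q
      * theta_ratio H r1 r2 q z)"
  proof (rule circle_integral_tendsto_weighted[OF R0])
    show "continuous_on (sphere 0 R) (theta_ratio H r1 r2 q)"
      by (intro continuous_intros q H) (use R in auto)
    fix n :: nat and z :: complex assume z: "norm z = R"
    show "norm (qpoch (H / (r1 * r2) * z) q n * qpoch (q / H * z) q n) \<le>
        exp (norm (H / (r1 * r2)) * R / (1 - norm q)) * exp (norm (q / H) * R / (1 - norm q))"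
      unfolding norm_mult[of "qpoch _ _ _"]
      by (intro mult_mono norm_qpoch_le q) (simp_all add: norm_mult norm_divide z)
  qed (intro continuous_intros tendsto_intros qpoch_tendsto q)+
  moreover have "(\<lambda>m. qpoch q q (2 * m)) \<longlonglongrightarrow> qpoch_inf q q"
    using LIMSEQ_subseq_LIMSEQ[OF qpoch_tendsto[OF q(2), of q], of "\<lambda>m. 2 * m"]
    by (simp add: o_def strict_mono_def)
  ultimately have "(\<lambda>m. qpoch q q (2 * m) * ?K m) \<longlonglongrightarrow> qpoch_inf q q * circle_integral R
      (\<lambda>z. qpoch_inf (H / (r1 * r2) * z) q * qpoch_inf (q / H * z) q * theta_ratio H r1 r2 q z)"
    by (rule tendsto_mult[rotated])
  thus "?P \<longlonglongrightarrow> qpoch_inf q q * circle_integral R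
      (\<lambda>z. qpoch_inf (H / (r1 * r2) * z) q * qpoch_inf (q / H * z) q * theta_ratio H r1 r2 q z)"
    unfolding circle_integral_theta_truncated[OF assms] .
  have "?P \<longlonglongrightarrow> 2 * of_real pi * (qpoch_inf (H / r1) q * qpoch_inf (H / r2) q * qpoch_inf (q * r1
      / H) q * qpoch_inf (q * r2 / H) q)"
    by (intro tendsto_intros qpoch_tendsto q)
  thus "?P \<longlonglongrightarrow> 2 * of_real pi * (qtheta (H / r1) q * qtheta (H / r2) q)"
    by (simp add: qtheta_def qpochs_inf_def mult_ac)
qed

text \<open>The factor depending on \<open>z\<close> in the integrand of the nonterminating \<open>q\<close>-Saalschuetz sum.
  The sum is balanced because the numerator parameter is the product \<open>e A B C\<close>.\<close>

definition saalschuetz_factor :: "complex \<Rightarrow> complex \<Rightarrow> complex \<Rightarrow> complex \<Rightarrow> complex \<Rightarrow> complex \<Rightarrow> complex \<Rightarrow> complex" where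
  "saalschuetz_factor H e A B C q z =
     qpoch_inf (e * A * B * C * z) q * qpoch_inf (H / e * z) q * qpoch_inf (q / H * z) q /
     (qpoch_inf (A * z) q * qpoch_inf (B * z) q * qpoch_inf (C * z) q)"

lemma saalschuetz_factor_commute:
  "saalschuetz_factor H e A B C q = saalschuetz_factor H e B A C q"
  "saalschuetz_factor H e A B C q = saalschuetz_factor H e C B A q"
  by (simp_all add: saalschuetz_factor_def fun_eq_iff mult_ac)

lemma continuous_on_saalschuetz_factor:
  assumes "norm q < 1" "norm A * R < 1" "norm B * R < 1" "norm C * R < 1"
  shows   "continuous_on (sphere 0 R) (saalschuetz_factor H e A B C q)"
proof -
  have "qpoch_inf (A * z) q * qpoch_inf (B * z) q * qpoch_inf (C * z) q \<noteq> 0" if "norm z = R" for z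
    using assms that by (simp add: qpoch_inf_nonzero norm_mult)
  thus ?thesis unfolding saalschuetz_factor_def
    by (intro continuous_intros assms(1)) auto
qed

text \<open>The function \<open>U\<close> contains \<open>q e A B C\<close> instead of \<open>e A B C\<close>; multiplication with
  \<open>1 - e A B C z\<close> restores the integrand, and multiplication with \<open>1 - A z\<close> replaces
  \<open>A\<close> by \<open>q A\<close>.\<close>

lemma saalschuetz_step:
  fixes q H r1 r2 A B C :: complex
  defines "e \<equiv> r1 * r2"
  assumes q: "q \<noteq> 0" "norm q < 1" and H: "H \<noteq> 0" and r: "r1 \<noteq> 0" "r2 \<noteq> 0"
    and R: "norm r1 < R" "norm r2 < R"
    and ABC: "norm A * R < 1" "norm B * R < 1" "norm C * R < 1"
  shows "(1 - A * r1) * (1 - A * r2) * circle_integral R (\<lambda>z. saalschuetz_factor H e A B C q z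
      * theta_ratio H r1 r2 q z)
       = (1 - e * A * B) * (1 - e * A * C) * circle_integral R (\<lambda>z. saalschuetz_factor H e (q
           * A) B C q z * theta_ratio H r1 r2 q z)"
proof -
  have R0: "R > 0" using R(1) norm_ge_zero[of r1] by linarith
  define U where "U = (\<lambda>z. qpoch_inf (q * (e * A * B * C) * z) q * qpoch_inf (H / e * z) q
      * qpoch_inf (q / H * z) q /
     (qpoch_inf (A * z) q * qpoch_inf (B * z) q * qpoch_inf (C * z) q))"
  define S where "S = {z. norm (A * z) < 1} \<inter> {z. norm (B * z) < 1} \<inter> {z. norm (C * z) < 1}"
  have S: "open S" unfolding S_def by (intro open_Int open_Collect_less continuous_intros)
  have inS: "z \<in> S" if "norm z \<le> R" for z
    using mult_left_mono[OF that, of "norm A"] mult_left_mono[OF that, of "norm B"]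
      mult_left_mono[OF that, of "norm C"] ABC by (simp add: S_def norm_mult)
  have nz: "qpoch_inf (A * z) q \<noteq> 0" "qpoch_inf (B * z) q \<noteq> 0" "qpoch_inf (C * z) q \<noteq> 0" if "z \<in> S" for z
    using that q by (simp_all add: S_def qpoch_inf_nonzero)
  have shift: "qpoch_inf (t * z) q = (1 - t * z) * qpoch_inf (q * t * z) q" for t z
    using qpoch_inf_step[OF q(2), of "t * z"] by (simp add: mult_ac)
  have func: "U (q * z) * (1 - H / e * z) * (1 - q / H * z) * (1 - q * (e * A * B * C) * z)
          = U z * (1 - A * z) * (1 - B * z) * (1 - C * z)" if z: "norm z = R" for z
  proof -
    have zS: "z \<in> S" using inS z by simp
    have alg: "a' * x' * y' / (f' * g' * h') * x * y * a = (a * a') * (x * x') * (y * y') / ((f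
        * f') * (g * g') * (h * h')) * f * g * h"
      if "f \<noteq> 0" "g \<noteq> 0" "h \<noteq> 0" for a a' x x' y y' f f' g g' h h' :: complex
      using that by (simp add: field_simps)
    have ne: "1 - A * z \<noteq> 0" "1 - B * z \<noteq> 0" "1 - C * z \<noteq> 0"
      using zS by (auto simp: S_def)
    have "U (q * z) = qpoch_inf (q * (q * (e * A * B * C)) * z) q * qpoch_inf (q * (H / e) * z) q
        * qpoch_inf (q * (q / H) * z) q /
     (qpoch_inf (q * A * z) q * qpoch_inf (q * B * z) q * qpoch_inf (q * C * z) q)"
      by (simp add: U_def mult_ac)
    moreover have "U z = ((1 - q * (e * A * B * C) * z) * qpoch_inf (q * (q * (e * A * B * C)) * z) q)
       * ((1 - H / e * z) * qpoch_inf (q * (H / e) * z) q) * ((1 - q / H * z) * qpoch_inf (q * (q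
           / H) * z) q) /
      (((1 - A * z) * qpoch_inf (q * A * z) q) * ((1 - B * z) * qpoch_inf (q * B * z) q) * ((1 - C
          * z) * qpoch_inf (q * C * z) q))"
      unfolding U_def by (simp only: shift[symmetric])
    ultimately show ?thesis by (simp only:) (rule alg[OF ne])
  qed
  have hol: "U holomorphic_on S"
    unfolding U_def by (intro holomorphic_intros q) (use nz in auto)
  have "(1 - A * r1) * (1 - A * r2) * circle_integral R (\<lambda>z. (1 - r1 * r2 * A * B * C * z) * U z
      * theta_ratio H r1 r2 q z)
       = (1 - r1 * r2 * A * B) * (1 - r1 * r2 * A * C) * circle_integral R (\<lambda>z. (1 - A * z) * U z
           * theta_ratio H r1 r2 q z)"
    by (rule circle_integral_contiguous[OF q H r R S inS hol func[unfolded e_def]])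
  moreover have "circle_integral R (\<lambda>z. (1 - r1 * r2 * A * B * C * z) * U z * theta_ratio H r1 r2 q z)
      = circle_integral R (\<lambda>z. saalschuetz_factor H e A B C q z * theta_ratio H r1 r2 q z)"
    unfolding e_def [symmetric] saalschuetz_factor_def shift[of "e * A * B * C"] U_def
    by (simp add: mult_ac)
  moreover have "circle_integral R (\<lambda>z. (1 - A * z) * U z * theta_ratio H r1 r2 q z)
      = circle_integral R (\<lambda>z. saalschuetz_factor H e (q * A) B C q z * theta_ratio H r1 r2 q z)"
  proof (rule circle_integral_cong[OF R0])
    fix z :: complex assume "norm z = R"
    hence "z \<in> S" using inS by simp
    hence "1 - A * z \<noteq> 0" by (auto simp: S_def)
    thus "(1 - A * z) * U z * theta_ratio H r1 r2 q z = saalschuetz_factor H e (q * A) B C q z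
        * theta_ratio H r1 r2 q z"
      unfolding saalschuetz_factor_def U_def shift[of A] by (simp add: mult_ac)
  qed
  ultimately show ?thesis by (simp add: e_def)
qed

lemma saalschuetz_remove_parameter:
  fixes q H r1 r2 A B C :: complex
  defines "e \<equiv> r1 * r2"
  assumes q: "q \<noteq> 0" "norm q < 1" and H: "H \<noteq> 0" and r: "r1 \<noteq> 0" "r2 \<noteq> 0"
    and R: "norm r1 < R" "norm r2 < R"
    and ABC: "norm A * R < 1" "norm B * R < 1" "norm C * R < 1"
  shows "qpoch_inf (A * r1) q
      * qpoch_inf (A * r2) q * circle_integral R (\<lambda>z. saalschuetz_factor H e A B C q z
          * theta_ratio H r1 r2 q z)
       = qpoch_inf (e * A * B) q * qpoch_inf (e * A * C) q
           * circle_integral R (\<lambda>z. saalschuetz_factor H e 0 B C q z * theta_ratio H r1 r2 q z)"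
proof (rule LIMSEQ_unique)
  have R0: "R > 0" using R(1) norm_ge_zero[of r1] by linarith
  define I where "I = (\<lambda>A. circle_integral R (\<lambda>z. saalschuetz_factor H e A B C q z
      * theta_ratio H r1 r2 q z))"
  have qA: "norm (q ^ n * A) * R \<le> norm A * R" for n
    using q R0 by (intro mult_right_mono) (simp_all add: norm_mult norm_power mult_left_le_one_le power_le_one)
  have iter: "qpoch (A * r1) q n * qpoch (A * r2) q n * I A
       = qpoch (e * A * B) q n * qpoch (e * A * C) q n * I (q ^ n * A)" for n
  proof (induction n)
    case (Suc n)
    have "norm (q ^ n * A) * R < 1" using qA[of n] ABC(1) by linarith
    from saalschuetz_step[OF q H r R this ABC(2,3)]
    have *: "(1 - A * r1 * q ^ n) * (1 - A * r2 * q ^ n) * I (q ^ n * A)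
       = (1 - e * A * B * q ^ n) * (1 - e * A * C * q ^ n) * I (q ^ Suc n * A)"
      by (simp add: I_def e_def mult_ac)
    have "qpoch (A * r1) q (Suc n) * qpoch (A * r2) q (Suc n) * I A
        = (qpoch (A * r1) q n * qpoch (A * r2) q n * I A) * ((1 - A * r1 * q ^ n) * (1 - A * r2
            * q ^ n))"
      by (simp add: qpoch_Suc mult_ac)
    also have "\<dots> = qpoch (e * A * B) q n * qpoch (e * A * C) q n *
        ((1 - A * r1 * q ^ n) * (1 - A * r2 * q ^ n) * I (q ^ n * A))"
      unfolding Suc.IH by (simp add: mult_ac)
    also have "\<dots> = qpoch (e * A * B) q (Suc n) * qpoch (e * A * C) q (Suc n) * I (q ^ Suc n * A)"
      unfolding * by (simp add: qpoch_Suc mult_ac)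
    finally show ?case .
  qed simp
  have "(\<lambda>n. I (q ^ n * A)) \<longlonglongrightarrow> I 0"
    unfolding I_def
  proof (rule circle_integral_tendsto_weighted[OF R0])
    show "continuous_on (sphere 0 R) (theta_ratio H r1 r2 q)"
      by (intro continuous_intros q H) (use R in auto)
    show "continuous_on (sphere 0 R) (saalschuetz_factor H e (q ^ n * A) B C q)" for n
      by (intro continuous_on_saalschuetz_factor q ABC(2,3)) (use qA[of n] ABC(1) in linarith)
    define I where "I = (\<lambda>a. exp (norm (a::complex) * R / (1 - norm a * R) / (1 - norm q)))"
    define E where "E = (\<lambda>a. exp (norm (a::complex) * R / (1 - norm q)))"
    fix z :: complex assume z: "norm z = R"
    show "norm (saalschuetz_factor H e (q ^ n * A) B C q z) \<le> (E (e * A * B * C) * E (H / e)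
        * E (q / H)) * (I A * I B * I C)" for n
    proof -
      have "norm (saalschuetz_factor H e (q ^ n * A) B C q z) =
          (norm (qpoch_inf (e * (q ^ n * A) * B * C * z) q) * norm (qpoch_inf (H / e * z) q)
              * norm (qpoch_inf (q / H * z) q)) *
           (norm (inverse (qpoch_inf (q ^ n * A * z) q)) * norm (inverse (qpoch_inf (B * z) q))
               * norm (inverse (qpoch_inf (C * z) q)))"
        by (simp add: saalschuetz_factor_def norm_mult norm_divide norm_inverse divide_inverse)
      also have "\<dots> \<le> (E (e * A * B * C) * E (H / e) * E (q / H)) * (I A * I B * I C)"
        unfolding I_def E_def
      proof (intro mult_mono norm_qpoch_inf_le norm_inverse_qpoch_inf_le mult_nonneg_nonneg)
        show "norm (q ^ n * A * z) \<le> norm A * R" using qA[of n] by (simp add: norm_mult z)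
        have "norm (e * (q ^ n * A) * B * C * z) = norm (e * B * C) * (norm (q ^ n * A) * R)"
          by (simp add: norm_mult z)
        also have "\<dots> \<le> norm (e * B * C) * (norm A * R)" by (intro mult_left_mono qA) auto
        finally show "norm (e * (q ^ n * A) * B * C * z) \<le> norm (e * A * B * C) * R"
          by (simp add: norm_mult mult_ac)
      qed (use z q ABC in \<open>auto simp: norm_mult norm_divide\<close>)
      finally show ?thesis .
    qed
    have "(\<lambda>n. q ^ n) \<longlonglongrightarrow> 0" by (rule LIMSEQ_power_zero[OF q(2)])
    hence "(\<lambda>n. saalschuetz_factor H e (q ^ n * A) B C q z) \<longlonglongrightarrow> saalschuetz_factor H e (0 * A) B C q z"
      unfolding saalschuetz_factor_def
      using z q ABC by (intro tendsto_intros q) (simp add: qpoch_inf_nonzero norm_mult)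
    thus "(\<lambda>n. saalschuetz_factor H e (q ^ n * A) B C q z) \<longlonglongrightarrow> saalschuetz_factor H e 0 B C q z"
      by simp
  qed
  hence "(\<lambda>n. qpoch (e * A * B) q n * qpoch (e * A * C) q n * I (q ^ n * A)) \<longlonglongrightarrow>
      qpoch_inf (e * A * B) q * qpoch_inf (e * A * C) q * I 0"
    by (intro tendsto_intros qpoch_tendsto q)
  thus "(\<lambda>n. qpoch (A * r1) q n * qpoch (A * r2) q n * I A) \<longlonglongrightarrow>
      qpoch_inf (e * A * B) q * qpoch_inf (e * A * C) q * I 0"
    unfolding iter .
  show "(\<lambda>n. qpoch (A * r1) q n * qpoch (A * r2) q n * I A) \<longlonglongrightarrow>
      qpoch_inf (A * r1) q * qpoch_inf (A * r2) q * I A"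
    by (intro tendsto_intros qpoch_tendsto q)
qed

text \<open>The nonterminating \<open>q\<close>-Saalschuetz sum in integral form. The three parameters are sent to \<open>0\<close>
  one after the other, each producing its own factors, until only the theta functions
  remain. The parameters \<open>r1\<close> and \<open>r2\<close> are kept independent of each other: later on \<open>r1\<close> is
  multiplied by powers of \<open>q\<close> while \<open>r2\<close> and the circle stay the same.\<close>

theorem saalschuetz_integral:
  fixes q H r1 r2 A B C :: complex
  defines "e \<equiv> r1 * r2"
  assumes q: "q \<noteq> 0" "norm q < 1" and H: "H \<noteq> 0" and r: "r1 \<noteq> 0" "r2 \<noteq> 0"
    and R: "norm r1 < R" "norm r2 < R"
    and ABC: "norm A * R < 1" "norm B * R < 1" "norm C * R < 1"
  shows "circle_integral R (\<lambda>z. saalschuetz_factor H e A B C q z * theta_ratio H r1 r2 q z) =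
     2 * of_real pi * (qtheta (H / r1) q * qtheta (H / r2) q) *
       (qpoch_inf (e * A * B) q * qpoch_inf (e * A * C) q * qpoch_inf (e * B * C) q) /
       (qpoch_inf q q * (qpoch_inf (A * r1) q * qpoch_inf (B * r1) q * qpoch_inf (C * r1) q) *
         (qpoch_inf (A * r2) q * qpoch_inf (B * r2) q * qpoch_inf (C * r2) q))"
proof -
  define I where "I = (\<lambda>A B C. circle_integral R (\<lambda>z. saalschuetz_factor H e A B C q z
      * theta_ratio H r1 r2 q z))"
  have comm: "I A B C = I B A C" "I A B C = I C B A" for A B C
    unfolding I_def using saalschuetz_factor_commute[of H e A B C q] by simp_all
  have rem: "qpoch_inf (A * r1) q * qpoch_inf (A * r2) q * I A B C
        = qpoch_inf (e * A * B) q * qpoch_inf (e * A * C) q * I 0 B C"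
    if "norm A * R < 1" "norm B * R < 1" "norm C * R < 1" for A B C
    using saalschuetz_remove_parameter[OF q H r R that] by (simp add: I_def e_def)
  have 1: "qpoch_inf (A * r1) q * qpoch_inf (A * r2) q * I A B C
        = qpoch_inf (e * A * B) q * qpoch_inf (e * A * C) q * I 0 B C"
    by (rule rem[OF ABC])
  have 2: "qpoch_inf (B * r1) q * qpoch_inf (B * r2) q * I 0 B C = qpoch_inf (e * B * C) q * I 0 0 C"
    using rem[of B 0 C] ABC comm(1)[of B 0 C] by simp
  have 3: "qpoch_inf (C * r1) q * qpoch_inf (C * r2) q * I 0 0 C = I 0 0 0"
    using rem[of C 0 0] ABC comm(2)[of C 0 0] by simp
  have 4: "qpoch_inf q q * I 0 0 0 = 2 * of_real pi * (qtheta (H / r1) q * qtheta (H / r2) q)"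
    using circle_integral_theta[OF q H r R] by (simp add: I_def saalschuetz_factor_def e_def)
  have lt: "norm (X * s) < 1" if "norm X * R < 1" "norm s < R" for X s :: complex
    using mult_left_mono[of "norm s" R "norm X"] that by (simp add: norm_mult)
  have nz: "qpoch_inf (X * s) q \<noteq> 0" if "norm X * R < 1" "norm s < R" for X s
    by (intro qpoch_inf_nonzero q lt that)
  define P where "P = (qpoch_inf (A * r1) q * qpoch_inf (B * r1) q * qpoch_inf (C * r1) q) *
         (qpoch_inf (A * r2) q * qpoch_inf (B * r2) q * qpoch_inf (C * r2) q)"
  have P: "P \<noteq> 0" unfolding P_def by (simp add: nz ABC R)
  have "qpoch_inf q q * P * I A B C = 
     2 * of_real pi * (qtheta (H / r1) q * qtheta (H / r2) q) *
       (qpoch_inf (e * A * B) q * qpoch_inf (e * A * C) q * qpoch_inf (e * B * C) q)"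
  proof -
    have "qpoch_inf q q * P * I A B C = qpoch_inf q q *
       (qpoch_inf (C * r1) q * qpoch_inf (C * r2) q * (qpoch_inf (B * r1) q * qpoch_inf (B * r2) q *
         (qpoch_inf (A * r1) q * qpoch_inf (A * r2) q * I A B C)))"
      by (simp add: P_def mult_ac)
    also have "\<dots> = qpoch_inf (e * A * B) q * qpoch_inf (e * A * C) q * qpoch_inf q q *
        (qpoch_inf (C * r1) q * qpoch_inf (C * r2) q * (qpoch_inf (B * r1) q * qpoch_inf (B
            * r2) q * I 0 B C))"
      unfolding 1 by (simp only: mult_ac)
    also have "\<dots> = qpoch_inf (e * A * B) q * qpoch_inf (e * A * C) q * qpoch_inf (e * B * C) q * 
       (qpoch_inf q q * (qpoch_inf (C * r1) q * qpoch_inf (C * r2) q * I 0 0 C))"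
      unfolding 2 by (simp only: mult_ac)
    finally show ?thesis unfolding 3 4 by (simp only: mult_ac)
  qed
  moreover have "qpoch_inf q q \<noteq> 0" by (rule qpoch_inf_nonzero[OF q(2) q(2)])
  ultimately have "I A B C = 2 * of_real pi * (qtheta (H / r1) q * qtheta (H / r2) q) *
       (qpoch_inf (e * A * B) q * qpoch_inf (e * A * C) q * qpoch_inf (e * B * C) q)
           / (qpoch_inf q q * P)"
    using P by (simp add: nonzero_eq_divide_eq mult_ac)
  thus ?thesis unfolding P_def I_def by (simp only: mult.assoc)
qed

section \<open>The cubic series as an integral\<close>

lemma qtheta_shift:
  assumes "norm q < 1" "q \<noteq> 0" "t \<noteq> 0"
  shows   "qtheta t q = - (t * qtheta (t * q) q)"
proof -
  have "qtheta t q = (1 - t) * qpoch_inf (t * q) q * qpoch_inf (q / t) q"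
    using qpoch_inf_step[OF assms(1), of t] by (simp add: qtheta_def qpochs_inf_def)
  moreover have "t * qtheta (t * q) q = (t - 1) * qpoch_inf (t * q) q * qpoch_inf (q / t) q"
  proof -
    have "q / (t * q) = 1 / t" using assms(2) by simp
    hence "qtheta (t * q) q = qpoch_inf (t * q) q * ((1 - 1 / t) * qpoch_inf (q / t) q)"
      using qpoch_inf_step[OF assms(1), of "1 / t"] by (simp add: qtheta_def qpochs_inf_def)
    moreover have "t * (1 - 1 / t) = t - 1" using assms(3) by (simp add: field_simps)
    ultimately show ?thesis by (metis mult.assoc mult.left_commute)
  qed
  ultimately have "qtheta t q + t * qtheta (t * q) q = 0"
    by (simp only:) (simp add: algebra_simps)
  thus ?thesis by (simp add: eq_neg_iff_add_eq_0)
qed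

text \<open>The factor \<open>c\<close> is \<open>(-1)\<^sup>n\<close> times a power of \<open>q\<close>. The point is that it is the same for
  all \<open>t\<close>, so that it cancels in quotients of theta functions.\<close>

lemma qtheta_quasiperiodic:
  assumes "norm q < 1" "q \<noteq> 0"
  obtains c where "\<And>t. t \<noteq> 0 \<Longrightarrow> qtheta t q = c * t ^ n * qtheta (t * q ^ n) q"
proof -
  have "\<exists>c. \<forall>t. t \<noteq> 0 \<longrightarrow> qtheta t q = c * t ^ n * qtheta (t * q ^ n) q"
  proof (induction n)
    case 0
    show ?case by (rule exI[of _ 1]) simp
  next
    case (Suc n)
    then obtain c where c: "\<And>t. t \<noteq> 0 \<Longrightarrow> qtheta t q = c * t ^ n * qtheta (t * q ^ n) q" by blast
    have "qtheta t q = (- c * q ^ n) * t ^ Suc n * qtheta (t * q ^ Suc n) q" if "t \<noteq> 0" for t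
      using c[OF that] qtheta_shift[OF assms, of "t * q ^ n"] assms(2) that
      by (simp add: mult_ac)
    thus ?case by blast
  qed
  thus ?thesis using that by blast
qed

lemma prod_diff_reciprocal:
  fixes d p :: complex
  assumes "d \<noteq> 0"
  shows   "(\<Prod>j<k. 1 / d - p ^ j) = (1 / d) ^ k * qpoch d p k"
proof -
  have "(\<Prod>j<k. 1 / d - p ^ j) = (\<Prod>j<k. 1 / d * (1 - d * p ^ j))"
    using assms by (intro prod.cong) (auto simp: field_simps)
  thus ?thesis unfolding qpoch_def prod.distrib by simp
qed

text \<open>The part of the term of the very-well-poised series in base \<open>q\<^sup>3\<close> that contains only the
  leading parameter. The quotient in front comes from the parameters \<open>\<plusminus>q\<^sup>3\<surd>a\<close> and \<open>\<plusminus>\<surd>a\<close>.\<close>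

definition cubic_coeff :: "complex \<Rightarrow> complex \<Rightarrow> nat \<Rightarrow> complex" where
  "cubic_coeff a q k = (1 - a * q ^ (6 * k)) / (1 - a) * (qpoch a (q ^ 3) k / qpoch (q ^ 3) (q ^ 3) k)"

text \<open>Rogers' sum in base \<open>q\<^sup>3\<close> with the parameters \<open>b\<close>, \<open>q b\<close> and \<open>q\<^sup>2 b\<close>, for which the shifted
  factorials in base \<open>q\<^sup>3\<close> combine into ones in base \<open>q\<close>.\<close>

lemma cubic_rogers_sum:
  assumes q: "q \<noteq> 0" "norm q < 1" and b: "b \<noteq> 0" "norm b < 1"
    and lt: "norm (q * a / b) < 1" "norm (a / b ^ 3) < 1"
  shows "(\<lambda>k. cubic_coeff a q k * (qpoch b q (3 * k) / qpoch (q * a / b) q (3 * k)) * (a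
      / b ^ 3) ^ k) sums
     (qpoch_inf (q ^ 3 * a) (q ^ 3) * qpoch_inf (a / b\<^sup>2) q /
       (qpoch_inf (q * a / b) q * qpoch_inf (a / b ^ 3) (q ^ 3)))"
proof -
  define p where "p = q ^ 3"
  define d where "d = q\<^sup>2 * b"
  have p: "norm p < 1" unfolding p_def by (rule norm_power_less_one[OF q(2)]) simp
  have d: "d \<noteq> 0" using q b by (simp add: d_def)
  have qb: "q * b \<noteq> 0" using q b by simp
  have a_b2: "norm (a / b\<^sup>2) < 1"
  proof -
    have "a / b\<^sup>2 = a / b ^ 3 * b" using b by (simp add: power2_eq_square power3_eq_cube)
    hence "norm (a / b\<^sup>2) = norm (a / b ^ 3) * norm b" by (simp only: norm_mult)
    also have "\<dots> \<le> norm (a / b ^ 3) * 1" using b by (intro mult_left_mono) auto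
    finally show ?thesis using lt(2) by simp
  qed
  have a1: "norm a < 1"
  proof -
    have "a = a / b\<^sup>2 * b\<^sup>2" using b by simp
    hence "norm a = norm (a / b\<^sup>2) * (norm b)\<^sup>2" by (metis norm_mult norm_power)
    also have "\<dots> \<le> norm (a / b\<^sup>2) * 1" using b by (intro mult_left_mono power_le_one) auto
    finally show ?thesis using a_b2 by simp
  qed
  have small: "norm (t * q ^ n) < 1" if "norm t < 1" for t n
  proof -
    have "norm t * norm q ^ n \<le> norm t * 1" using q by (intro mult_left_mono power_le_one) auto
    thus ?thesis using that by (simp add: norm_mult norm_power)
  qed
  have e1: "a * p / b = q\<^sup>2 * (q * a / b)" "a * p / (q * b) = q * (q * a / b)"
      "a * p * (1 / d) = q * a / b" "a * p / (b * (q * b)) = q\<^sup>2 * (a / b\<^sup>2)"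
      "q * a / b / b = q * (a / b\<^sup>2)" "q * a / b / (q * b) = a / b\<^sup>2"
      "q * a / b / (b * (q * b)) = a / b ^ 3"
    using q b by (simp_all add: p_def d_def power2_eq_square power3_eq_cube field_simps)
  have rog: "rogers_term a b (q * b) p (1 / d) sums
     ((1 - a) * (qpoch_inf (a * p) p * qpoch_inf (q\<^sup>2 * (a / b\<^sup>2)) p *
                 qpoch_inf (q * (a / b\<^sup>2)) p * qpoch_inf (a / b\<^sup>2) p) /
      (qpoch_inf (q\<^sup>2 * (q * a / b)) p * qpoch_inf (q * (q * a / b)) p *
       qpoch_inf (q * a / b) p * qpoch_inf (a / b ^ 3) p))"
  proof (rule rogers_sum[OF p b(1) qb, of a "1 / d", unfolded e1])
    show "norm (q\<^sup>2 * (q * a / b)) < 1" "norm (q * (q * a / b)) < 1" "norm (a * p) < 1"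
        "norm (q\<^sup>2 * (a / b\<^sup>2)) < 1" "norm (q * a / b) < 1" "norm (a / b ^ 3) < 1"
      using lt small[of "q * a / b" 2] small[of "q * a / b" 1] small[of a 3] small[of "a
          / b\<^sup>2" 2] a1 a_b2
      by (simp_all only: p_def mult.commute power_one_right)
  qed
  have term_eq: "rogers_term a b (q * b) p (1 / d) k =
     (1 - a) * (cubic_coeff a q k * (qpoch b q (3 * k) / qpoch (q * a / b) q (3 * k)) * (a
         / b ^ 3) ^ k)" for k
  proof -
    have 1: "1 - a \<noteq> 0" using a1 by auto
    have pw: "(a * p / (b * (q * b))) ^ k * (1 / d) ^ k = (a / b ^ 3) ^ k"
    proof -
      have "a * p / (b * (q * b)) * (1 / d) = a / b ^ 3"
        using q b by (simp add: p_def d_def power2_eq_square power3_eq_cube)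
      thus ?thesis by (simp only: power_mult_distrib [symmetric])
    qed
    have q6: "q ^ (6 * k) = p ^ (2 * k)" by (simp add: p_def power_mult [symmetric])
    have "rogers_term a b (q * b) p (1 / d) k = (1 - a * q ^ (6 * k)) * (qpoch a p k / qpoch p p k) *
       ((qpoch b p k * qpoch (q * b) p k * qpoch d p k) /
        (qpoch (q * a / b) p k * qpoch (q * (q * a / b)) p k * qpoch (q\<^sup>2 * (q * a / b)) p k)) *
        ((a * p / (b * (q * b))) ^ k * (1 / d) ^ k)"
      unfolding rogers_term_def well_poised_coeff_def prod_diff_reciprocal[OF d] e1(1-3) q6
      by (simp add: mult_ac)
    also have "\<dots> = (1 - a) * (cubic_coeff a q k * (qpoch b q (3 * k) / qpoch (q * a / b) q (3
        * k)) * (a / b ^ 3) ^ k)"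
      unfolding pw unfolding qpoch_triple d_def cubic_coeff_def p_def [symmetric] using 1 by (simp add: mult_ac)
    finally show ?thesis .
  qed
  have "1 - a \<noteq> 0" using a1 by auto
  with sums_divide[OF rog[unfolded term_eq], of "1 - a"]
  have "(\<lambda>k. cubic_coeff a q k * (qpoch b q (3 * k) / qpoch (q * a / b) q (3 * k)) * (a
      / b ^ 3) ^ k) sums
     (qpoch_inf (a * p) p * qpoch_inf (q\<^sup>2 * (a / b\<^sup>2)) p *
                 qpoch_inf (q * (a / b\<^sup>2)) p * qpoch_inf (a / b\<^sup>2) p /
      (qpoch_inf (q\<^sup>2 * (q * a / b)) p * qpoch_inf (q * (q * a / b)) p *
       qpoch_inf (q * a / b) p * qpoch_inf (a / b ^ 3) p))"
    by (simp add: mult_ac)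
  also have "qpoch_inf (a * p) p * qpoch_inf (q\<^sup>2 * (a / b\<^sup>2)) p *
                 qpoch_inf (q * (a / b\<^sup>2)) p * qpoch_inf (a / b\<^sup>2) p /
      (qpoch_inf (q\<^sup>2 * (q * a / b)) p * qpoch_inf (q * (q * a / b)) p *
       qpoch_inf (q * a / b) p * qpoch_inf (a / b ^ 3) p)
     = qpoch_inf (q ^ 3 * a) (q ^ 3) * qpoch_inf (a / b\<^sup>2) q /
       (qpoch_inf (q * a / b) q * qpoch_inf (a / b ^ 3) (q ^ 3))"
    unfolding qpoch_inf_triple[OF q(2), of "a / b\<^sup>2"] qpoch_inf_triple[OF q(2), of "q * a / b"]
    by (simp add: p_def mult_ac)
  finally show ?thesis .
qed

lemma norm_cubic_coeff_le:
  assumes q: "norm q < 1"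
  obtains C where "C \<ge> 0" "\<And>k. norm (cubic_coeff a q k) \<le> C"
proof -
  define p where "p = q ^ 3"
  have p: "norm p < 1" unfolding p_def by (rule norm_power_less_one[OF q]) simp
  define C where "C = (1 + norm a) / norm (1 - a) * (exp (norm a / (1 - norm p)) *
     exp (norm p / (1 - norm p) / (1 - norm p)))"
  have "norm (cubic_coeff a q k) \<le> C" for k
  proof -
    have "norm (1 - a * q ^ (6 * k)) \<le> 1 + norm (a * q ^ (6 * k))"
      by (metis norm_one norm_triangle_ineq4)
    also have "norm (a * q ^ (6 * k)) \<le> norm a"
      using q by (simp add: norm_mult norm_power mult_left_le power_le_one)
    finally have 1: "norm (1 - a * q ^ (6 * k)) \<le> 1 + norm a" by simp
    have "norm (cubic_coeff a q k) = norm (1 - a * q ^ (6 * k)) / norm (1 - a) *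
        (norm (qpoch a p k) * norm (inverse (qpoch p p k)))"
      by (simp add: cubic_coeff_def norm_mult norm_divide norm_inverse divide_inverse p_def)
    also have "\<dots> \<le> C"
      unfolding C_def
      by (intro mult_mono divide_right_mono 1 norm_qpoch_le norm_inverse_qpoch_le p) auto
    finally show ?thesis .
  qed
  moreover have "C \<ge> 0" by (simp add: C_def)
  ultimately show ?thesis using that by blast
qed

lemma circle_integral_mult_right: "circle_integral R (\<lambda>z. c * F z) = c * circle_integral R F"
  by (simp add: circle_integral_def)

lemma circle_integral_sum:
  assumes "R > 0" "\<And>k. k \<in> K \<Longrightarrow> continuous_on (sphere 0 R) (F k)" "finite K"
  shows   "circle_integral R (\<lambda>z. \<Sum>k\<in>K. F k z) = (\<Sum>k\<in>K. circle_integral R (F k))"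
  unfolding circle_integral_def
  by (rule integral_sum) (use assms in \<open>auto intro: integrable_circle\<close>)

text \<open>The series and the integral in terms of the parameters of the integrand: \<open>A r\<close>, \<open>B r\<close>, \<open>C r\<close>
  are the three free parameters of the series, and \<open>z\<close> is the variable of integration.
  For every \<open>k\<close>, the Saalschuetz integral with \<open>r q\<^sup>3\<^sup>k\<close> and
  \<open>1 / r\<close> as parameters \<open>r1\<close> and \<open>r2\<close> and with \<open>H = h r q\<^sup>3\<^sup>k\<close> reproduces the factors of the
  \<open>k\<close>-th term that contain these parameters. In all these integrals the integrand is \<open>T\<close> times the
  \<open>k\<close>-th term \<open>g k\<close> of a Rogers series with \<open>b = r / z\<close>, up to a constant. The terms are
  dominated by a geometric series on the circle, so summation and integration may be exchanged.\<close>

theorem cubic_integral_representation: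
  fixes q h r A B C a :: complex and R :: real
  assumes q: "q \<noteq> 0" "norm q < 1" and nz: "h \<noteq> 0" "r \<noteq> 0" "A \<noteq> 0" "B \<noteq> 0" "C \<noteq> 0"
    and a: "q * a = A * B * C * r"
    and R: "norm r < R" "norm (1 / r) < R"
    and ABC: "norm A * R < 1" "norm B * R < 1" "norm C * R < 1"
    and ar: "norm a * R ^ 3 < norm r ^ 3"
    and theta: "qtheta h q \<noteq> 0" "qtheta (h * r\<^sup>2) q \<noteq> 0"
  shows "(\<lambda>k. cubic_coeff a q k *
            (qpoch (A * r) q (3 * k) * qpoch (B * r) q (3 * k) * qpoch (C * r) q (3 * k) /
             (qpoch (A * B) q (3 * k) * qpoch (A * C) q (3 * k) * qpoch (B * C) q (3 * k))) *
            (a / r ^ 6) ^ k) sums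
     (qpoch_inf (A * r) q * qpoch_inf (B * r) q * qpoch_inf (C * r) q * qpoch_inf q q *
      (qpoch_inf (A / r) q * qpoch_inf (B / r) q * qpoch_inf (C / r) q) * qpoch_inf (q ^ 3 * a) (q ^ 3) /
      (2 * of_real pi * (qtheta h q * qtheta (h * r\<^sup>2) q) *
        (qpoch_inf (A * B) q * qpoch_inf (A * C) q * qpoch_inf (B * C) q)) *
      circle_integral R (\<lambda>z. qtheta (h * r / z) q * qtheta (h * r * z) q * qpoch_inf (a * z\<^sup>2 / r\<^sup>2) q /
        (qpoch_inf (r / z) q * qpoch_inf (1 / (r * z)) q *
         (qpoch_inf (A * z) q * qpoch_inf (B * z) q * qpoch_inf (C * z) q) *
         qpoch_inf (a * z ^ 3 / r ^ 3) (q ^ 3))))"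
proof -
  have R0: "R > 0" using R(1) norm_ge_zero[of r] by linarith
  \<comment> \<open>Both \<open>r\<close> and its reciprocal are smaller than \<open>R\<close>; this makes \<open>A\<close>, \<open>B\<close>, \<open>C\<close> and their
      products smaller than \<open>1\<close>.\<close>
  have R1: "R > 1"
  proof (rule ccontr)
    assume "\<not> R > 1"
    hence "norm r < 1" "norm (1 / r) < 1" using R by linarith+
    thus False using nz by (simp add: norm_divide divide_simps split: if_splits)
  qed
  define D where "D = A * B * C"
  have D: "q * a / (r / z) = D * z" for z
    using a nz by (simp add: D_def)
  have less_one: "norm X < 1" if "norm X * R < 1" for X :: complex
    using that R1 mult_left_mono[of 1 R "norm X"] by simp
  have D1: "norm D * R < 1"
  proof -
    have "norm A * norm B * (norm C * R) \<le> 1 * 1 * (norm C * R)"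
      using less_one[OF ABC(1)] less_one[OF ABC(2)] R0 by (intro mult_right_mono mult_mono) auto
    thus ?thesis using ABC(3) by (simp add: D_def norm_mult mult_ac)
  qed
  have nzc: "qpoch_inf (A * z) q \<noteq> 0" "qpoch_inf (B * z) q \<noteq> 0" "qpoch_inf (C * z) q \<noteq> 0"
      "qpoch_inf (D * z) q \<noteq> 0" "qpoch_inf (r / z) q \<noteq> 0" "qpoch_inf (1 / (r * z)) q \<noteq> 0"
    if "norm z = R" for z
  proof -
    have "norm (1 / (r * z)) = norm (1 / r) / R" using that by (simp add: norm_divide norm_mult)
    hence "norm (1 / (r * z)) < 1" using R(2) R0 by simp
    thus "qpoch_inf (1 / (r * z)) q \<noteq> 0" using q by (intro qpoch_inf_nonzero)
  qed (use that ABC D1 R q R0 in \<open>simp_all add: qpoch_inf_nonzero norm_mult norm_divide\<close>)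
  define pre where "pre = qpoch_inf (A * r) q * qpoch_inf (B * r) q * qpoch_inf (C * r) q
      * qpoch_inf q q *
      (qpoch_inf (A / r) q * qpoch_inf (B / r) q * qpoch_inf (C / r) q) /
      (2 * of_real pi * (qtheta h q * qtheta (h * r\<^sup>2) q) *
        (qpoch_inf (A * B) q * qpoch_inf (A * C) q * qpoch_inf (B * C) q))"
  define T where "T = (\<lambda>z. qtheta (h * r / z) q * qtheta (h * r * z) q * qpoch_inf (D * z) q /
        (qpoch_inf (r / z) q * qpoch_inf (1 / (r * z)) q *
         (qpoch_inf (A * z) q * qpoch_inf (B * z) q * qpoch_inf (C * z) q)))"
  define g where "g = (\<lambda>k z. cubic_coeff a q k *
      (qpoch (r / z) q (3 * k) / qpoch (D * z) q (3 * k)) * (a / (r / z) ^ 3) ^ k)"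
  define L where "L = (\<lambda>z. qpoch_inf (q ^ 3 * a) (q ^ 3) * qpoch_inf (a / (r / z)\<^sup>2) q /
       (qpoch_inf (D * z) q * qpoch_inf (a / (r / z) ^ 3) (q ^ 3)))"
  have zn0: "z \<noteq> 0" if "norm z = R" for z :: complex using that R0 by auto
  have contT: "continuous_on (sphere 0 R) T"
    unfolding T_def qtheta_def qpochs_inf_def using nzc zn0 nz
    by (auto intro!: continuous_intros q)
  have g_sums: "(\<lambda>k. g k z) sums L z" if z: "norm z = R" for z
  proof -
    have "norm (a / (r / z) ^ 3) < 1"
      using ar nz z R0 by (simp add: norm_divide norm_mult norm_power power_divide)
    moreover have "norm (q * a / (r / z)) < 1" using D1 z unfolding D by (simp add: norm_mult)
    ultimately have "(\<lambda>k. cubic_coeff a q k * (qpoch (r / z) q (3 * k) / qpoch (q * a / (r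
        / z)) q (3 * k)) * (a / (r / z) ^ 3) ^ k) sums
     (qpoch_inf (q ^ 3 * a) (q ^ 3) * qpoch_inf (a / (r / z)\<^sup>2) q /
       (qpoch_inf (q * a / (r / z)) q * qpoch_inf (a / (r / z) ^ 3) (q ^ 3)))"
      using nz zn0[OF z] z R R0 by (intro cubic_rogers_sum q) (auto simp: norm_divide)
    thus ?thesis unfolding g_def L_def D .
  qed
  define s where "s = norm a * R ^ 3 / norm r ^ 3"
  have s: "0 \<le> s" "s < 1" using ar R0 nz by (auto simp: s_def)
  obtain C0 where C0: "C0 \<ge> 0" "\<And>k. norm (cubic_coeff a q k) \<le> C0"
    using norm_cubic_coeff_le[OF q(2)] by metis
  define C1 where "C1 = C0 * (exp (norm r / R / (1 - norm q)) * exp (norm D * R / (1 - norm D * R)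
      / (1 - norm q)))"
  have g_bound: "norm (g k z) \<le> C1 * s ^ k" if z: "norm z = R" for k z
  proof -
    have "norm (g k z) = norm (cubic_coeff a q k) * (norm (qpoch (r / z) q (3 * k)) *
        norm (inverse (qpoch (D * z) q (3 * k)))) * s ^ k"
      using z by (simp add: g_def s_def norm_mult norm_divide norm_power norm_inverse divide_inverse power_mult_distrib power_inverse)
    also have "\<dots> \<le> C1 * s ^ k"
      unfolding C1_def
      by (intro mult_right_mono mult_mono C0 norm_qpoch_le norm_inverse_qpoch_le q mult_nonneg_nonneg)
         (use z D1 s in \<open>auto simp: norm_mult norm_divide\<close>)
    finally show ?thesis .
  qed
  have contg: "continuous_on (sphere 0 R) (g k)" for k
  proof -
    have "qpoch (D * z) q (3 * k) \<noteq> 0" if "norm z = R" for z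
      using that D1 q by (intro qpoch_nonzero) (auto simp: norm_mult)
    thus ?thesis unfolding g_def using zn0 nz by (auto intro!: continuous_intros)
  qed
  have C1: "C1 \<ge> 0" using C0(1) by (simp add: C1_def)
  have "(\<lambda>N. circle_integral R (\<lambda>z. (\<Sum>k<N. g k z) * T z)) \<longlonglongrightarrow> circle_integral R (\<lambda>z. L z * T z)"
  proof (rule circle_integral_tendsto_weighted[OF R0 _ contT])
    show "continuous_on (sphere 0 R) (\<lambda>z. \<Sum>k<N. g k z)" for N
      by (intro continuous_intros contg)
    fix z :: complex and N assume z: "norm z = R"
    have "norm (\<Sum>k<N. g k z) \<le> (\<Sum>k<N. C1 * s ^ k)"
      by (intro sum_norm_le g_bound z)
    also have "\<dots> \<le> (\<Sum>k. C1 * s ^ k)"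
      using s C1 by (intro sum_le_suminf summable_mult summable_geometric) auto
    finally show "norm (\<Sum>k<N. g k z) \<le> (\<Sum>k. C1 * s ^ k)" .
    show "(\<lambda>N. \<Sum>k<N. g k z) \<longlonglongrightarrow> L z" using g_sums[OF z] by (simp add: sums_def)
  qed
  moreover have "circle_integral R (\<lambda>z. (\<Sum>k<N. g k z) * T z) = (\<Sum>k<N. circle_integral R (\<lambda>z. g k z
      * T z))" for N
    unfolding sum_distrib_right
    by (rule circle_integral_sum[OF R0]) (auto intro!: continuous_intros contg contT)
  ultimately have sums: "(\<lambda>k. circle_integral R (\<lambda>z. g k z * T z)) sums circle_integral R (\<lambda>z. L z
      * T z)"
    by (simp add: sums_def)
  have term_eq: "pre * circle_integral R (\<lambda>z. g k z * T z) = cubic_coeff a q k *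
            (qpoch (A * r) q (3 * k) * qpoch (B * r) q (3 * k) * qpoch (C * r) q (3 * k) /
             (qpoch (A * B) q (3 * k) * qpoch (A * C) q (3 * k) * qpoch (B * C) q (3 * k))) *
            (a / r ^ 6) ^ k" for k
  proof -
    define Q where "Q = q ^ (3 * k)"
    have Q0: "Q \<noteq> 0" and Q1: "norm Q \<le> 1"
      using q by (auto simp: Q_def norm_power power_le_one)
    obtain c where c: "\<And>t. t \<noteq> 0 \<Longrightarrow> qtheta t q = c * t ^ (3 * k) * qtheta (t * Q) q"
      using qtheta_quasiperiodic[OF q(2,1), of "3 * k"] unfolding Q_def by metis
    have th: "qtheta (h * r\<^sup>2) q = c * (h * r\<^sup>2) ^ (3 * k) * qtheta (h * r\<^sup>2 * Q) q"
      using nz by (intro c) auto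
    have c0: "c \<noteq> 0" "qtheta (h * r\<^sup>2 * Q) q \<noteq> 0" using th theta by auto
    \<comment> \<open>Here \<open>e = r1 r2 = Q\<close>, so the theta function with argument \<open>H z / e = h r z\<close> is the same for
        all \<open>k\<close>, while the other one contributes the power of \<open>r z\<close> in \<open>g k\<close>.\<close>
    define H where "H = h * r * Q"
    have "norm (r * Q) \<le> norm r" using Q1 by (simp add: norm_mult mult_left_le)
    hence rQ: "norm (r * Q) < R" using R by linarith
    have H0: "H \<noteq> 0" "r * Q \<noteq> 0" "1 / r \<noteq> 0" using nz Q0 by (auto simp: H_def)
    note sa = saalschuetz_integral[OF q H0 rQ R(2) ABC]
    have simps: "r * Q * (1 / r) = Q" "H / (r * Q) = h" "H / (1 / r) = h * r\<^sup>2 * Q"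
      using nz Q0 by (auto simp: H_def power2_eq_square)
    have point: "saalschuetz_factor H Q A B C q z * theta_ratio H (r * Q) (1 / r) q z =
        (qtheta (h * r\<^sup>2 * Q) q / qtheta (h * r\<^sup>2) q) *
          ((qpoch (r / z) q (3 * k) / qpoch (D * z) q (3 * k)) * (r * z) ^ (3 * k) * T z)"
      if z: "norm z = R" for z
    proof -
      have z0: "z \<noteq> 0" using zn0[OF z] .
      have hz: "qtheta (h * r / z) q = c * (h * r / z) ^ (3 * k) * qtheta (h * r / z * Q) q"
        using nz z0 by (intro c) auto
      have p1: "qpoch_inf (r / z) q = qpoch (r / z) q (3 * k) * qpoch_inf (r * Q / z) q"
        using qpoch_inf_split[OF q(2), of "r / z" "3 * k"] by (simp add: Q_def)
      have p2: "qpoch_inf (D * z) q = qpoch (D * z) q (3 * k) * qpoch_inf (Q * D * z) q"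
        using qpoch_inf_split[OF q(2), of "D * z" "3 * k"] by (simp add: Q_def mult_ac)
      have nzp: "qpoch (r / z) q (3 * k) \<noteq> 0" "qpoch (D * z) q (3 * k) \<noteq> 0"
        using nzc(4,5)[OF z] unfolding p1 p2 by auto
      have lhs: "saalschuetz_factor H Q A B C q z * theta_ratio H (r * Q) (1 / r) q z =
         qtheta (h * r / z * Q) q * qtheta (h * r * z) q * qpoch_inf (Q * D * z) q /
         (qpoch_inf (r * Q / z) q * qpoch_inf (1 / (r * z)) q *
         (qpoch_inf (A * z) q * qpoch_inf (B * z) q * qpoch_inf (C * z) q))"
      proof -
        have "qtheta (h * r / z * Q) q = qpoch_inf (H / z) q * qpoch_inf (q / H * z) q"
          by (simp add: qtheta_def qpochs_inf_def H_def mult_ac)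
        moreover have "qtheta (h * r * z) q = qpoch_inf (H / Q * z) q * qpoch_inf (q * Q / (H * z)) q"
          using Q0 by (simp add: qtheta_def qpochs_inf_def H_def mult_ac)
        moreover have "q * (r * Q * (1 / r)) / (H * z) = q * Q / (H * z)" using nz by simp
        moreover have "Q * A * B * C * z = Q * D * z" by (simp add: D_def mult_ac)
        moreover have "1 / r / z = 1 / (r * z)" by simp
        ultimately show ?thesis
          unfolding saalschuetz_factor_def theta_ratio_def
          by (simp only: times_divide_times_eq) (simp only: mult_ac)
      qed
      have alg: "x * w * u / (v * t * f) = (y / (c * Y * y)) * ((b / d) * X * ((c * Z * x) * w
          * (d * u) / ((b * v) * t * f)))"
        if "c \<noteq> 0" "Y \<noteq> 0" "y \<noteq> 0" "b \<noteq> 0" "d \<noteq> 0" "X * Z = Y" for x w u v t f y b d X Y Z :: complex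
      proof -
        have "(y / (c * Y * y)) * ((b / d) * X * ((c * Z * x) * w * (d * u) / ((b * v) * t * f)))
           = (c * (X * Z) * y * b * d) / (c * Y * y * b * d) * (x * w * u / (v * t * f))"
          by (simp only: times_divide_times_eq times_divide_eq_right times_divide_eq_left
              divide_divide_eq_left divide_divide_eq_right mult_ac)
        thus ?thesis using that by simp
      qed
      show ?thesis
        unfolding lhs T_def hz p1 p2 th
      proof (rule alg)
        show "(r * z) ^ (3 * k) * (h * r / z) ^ (3 * k) = (h * r\<^sup>2) ^ (3 * k)"
          unfolding power_mult_distrib [symmetric] using z0 by (simp add: power2_eq_square mult_ac)
      qed (use c0 nzp nz in auto)
    qed
    have "circle_integral R (\<lambda>z. saalschuetz_factor H Q A B C q z * theta_ratio H (r * Q) (1 / r) q z) =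
       circle_integral R (\<lambda>z. (qtheta (h * r\<^sup>2 * Q) q / qtheta (h * r\<^sup>2) q) *
          ((qpoch (r / z) q (3 * k) / qpoch (D * z) q (3 * k)) * (r * z) ^ (3 * k) * T z))"
      by (rule circle_integral_cong[OF R0 point])
    also have "\<dots> = (qtheta (h * r\<^sup>2 * Q) q / qtheta (h * r\<^sup>2) q) *
       circle_integral R (\<lambda>z. (qpoch (r / z) q (3 * k) / qpoch (D * z) q (3 * k)) * (r * z) ^ (3
           * k) * T z)"
      by (rule circle_integral_mult_right)
    finally have int1: "circle_integral R (\<lambda>z. (qpoch (r / z) q (3 * k) / qpoch (D * z) q (3 * k))
        * (r * z) ^ (3 * k) * T z)
      = qtheta (h * r\<^sup>2) q / qtheta (h * r\<^sup>2 * Q) q *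
        circle_integral R (\<lambda>z. saalschuetz_factor H Q A B C q z * theta_ratio H (r * Q) (1 / r) q z)"
      using c0 theta by simp
    have gT: "g k z * T z = cubic_coeff a q k * (a / r ^ 6) ^ k *
         ((qpoch (r / z) q (3 * k) / qpoch (D * z) q (3 * k)) * (r * z) ^ (3 * k)
             * T z)" if z: "norm z = R" for z
    proof -
      have "(a / r ^ 6) ^ k * (r * z) ^ (3 * k) = (a / r ^ 6 * (r * z) ^ 3) ^ k"
        unfolding power_mult power_mult_distrib by simp
      also have "a / r ^ 6 * (r * z) ^ 3 = a / (r / z) ^ 3"
        using nz zn0[OF z] by (simp add: power_mult_distrib power_divide field_simps power_add [symmetric])
      finally show ?thesis by (simp add: g_def mult_ac)
    qed
    have int2: "circle_integral R (\<lambda>z. g k z * T z) = cubic_coeff a q k * (a / r ^ 6) ^ k *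
       circle_integral R (\<lambda>z. (qpoch (r / z) q (3 * k) / qpoch (D * z) q (3 * k)) * (r * z) ^ (3
           * k) * T z)"
      unfolding circle_integral_mult_right [symmetric] by (rule circle_integral_cong[OF R0 gT])
    have sp: "qpoch_inf t q = qpoch t q (3 * k) * qpoch_inf (Q * t) q" for t
      using qpoch_inf_split[OF q(2), of t "3 * k"] by (simp add: Q_def mult_ac)
    have lt1: "norm (X * Y) < 1" if "norm X * R < 1" "norm Y < R" for X Y :: complex
    proof -
      have "norm X * norm Y \<le> norm X * R" using that by (intro mult_left_mono) auto
      thus ?thesis using that by (simp add: norm_mult)
    qed
    have lt2: "norm A < R" "norm B < R" "norm C < R"
      using less_one[OF ABC(1)] less_one[OF ABC(2)] less_one[OF ABC(3)] R1 by linarith+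
    have nz1: "qpoch_inf (A * r) q \<noteq> 0" "qpoch_inf (B * r) q \<noteq> 0" "qpoch_inf (C * r) q \<noteq> 0"
       "qpoch_inf (A * B) q \<noteq> 0" "qpoch_inf (A * C) q \<noteq> 0" "qpoch_inf (B * C) q \<noteq> 0"
      by (intro qpoch_inf_nonzero q lt1 ABC R lt2)+
    have nz2: "qpoch_inf (A / r) q \<noteq> 0" "qpoch_inf (B / r) q \<noteq> 0" "qpoch_inf (C / r) q \<noteq> 0"
      using lt1[OF ABC(1) R(2)] lt1[OF ABC(2) R(2)] lt1[OF ABC(3) R(2)] q
      by (simp_all add: qpoch_inf_nonzero)
    have nzq: "qpoch_inf q q \<noteq> 0" by (rule qpoch_inf_nonzero[OF q(2) q(2)])
    have sa': "circle_integral R (\<lambda>z. saalschuetz_factor H Q A B C q z * theta_ratio H (r * Q) (1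
        / r) q z) =
     2 * of_real pi * (qtheta h q * qtheta (h * r\<^sup>2 * Q) q) *
       (qpoch_inf (Q * (A * B)) q * qpoch_inf (Q * (A * C)) q * qpoch_inf (Q * (B * C)) q) /
       (qpoch_inf q q * (qpoch_inf (Q * (A * r)) q * qpoch_inf (Q * (B * r)) q * qpoch_inf (Q * (C
           * r)) q) *
         (qpoch_inf (A / r) q * qpoch_inf (B / r) q * qpoch_inf (C / r) q))"
      using sa unfolding simps by (simp only: mult_ac times_divide_eq_right mult_1_right mult_1_left)
    show ?thesis
      unfolding int2 int1 sa' pre_def
      using nz1 nz2 nzq c0 theta
      unfolding sp[of "A * r"] sp[of "B * r"] sp[of "C * r"] sp[of "A * B"] sp[of "A * C"] sp[of "B * C"]
      by (simp add: field_simps)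
  qed
  have "(\<lambda>k. pre * circle_integral R (\<lambda>z. g k z * T z)) sums (pre * circle_integral R (\<lambda>z. L z * T z))"
    by (rule sums_mult[OF sums])
  moreover have "circle_integral R (\<lambda>z. L z * T z) = qpoch_inf (q ^ 3 * a) (q ^ 3) *
      circle_integral R (\<lambda>z. qtheta (h * r / z) q * qtheta (h * r * z) q * qpoch_inf (a * z\<^sup>2 / r\<^sup>2) q /
        (qpoch_inf (r / z) q * qpoch_inf (1 / (r * z)) q *
         (qpoch_inf (A * z) q * qpoch_inf (B * z) q * qpoch_inf (C * z) q) *
         qpoch_inf (a * z ^ 3 / r ^ 3) (q ^ 3)))"
    unfolding circle_integral_mult_right [symmetric]
  proof (rule circle_integral_cong[OF R0])
    fix z :: complex assume z: "norm z = R"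
    have "a / (r / z)\<^sup>2 = a * z\<^sup>2 / r\<^sup>2" "a / (r / z) ^ 3 = a * z ^ 3 / r ^ 3"
      by (simp_all add: power_divide)
    moreover have alg: "P * N / (d * K) * (t1 * t2 * d / W) = P * (t1 * t2 * N / (W * K))"
      if "d \<noteq> 0" for P N d K t1 t2 W :: complex
      using that by (simp add: mult_ac)
    ultimately show "L z * T z = qpoch_inf (q ^ 3 * a) (q ^ 3) *
      (qtheta (h * r / z) q * qtheta (h * r * z) q * qpoch_inf (a * z\<^sup>2 / r\<^sup>2) q /
        (qpoch_inf (r / z) q * qpoch_inf (1 / (r * z)) q *
         (qpoch_inf (A * z) q * qpoch_inf (B * z) q * qpoch_inf (C * z) q) *
         qpoch_inf (a * z ^ 3 / r ^ 3) (q ^ 3)))"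
      unfolding L_def T_def using nzc(4)[OF z] by (simp only: alg)
  qed
  ultimately show ?thesis unfolding term_eq by (simp add: pre_def mult_ac)
qed

section \<open>Choice of the roots\<close>

lemma primitive_cube_root_sum:
  fixes \<omega> :: complex
  defines "\<omega> \<equiv> exp (2 / 3 * of_real pi * \<i>)"
  shows "1 + \<omega> + \<omega>\<^sup>2 = 0"
proof -
  have 1: "\<omega> = cis (2 * pi / 3)" by (simp add: \<omega>_def cis_conv_exp mult_ac)
  have "(1 - \<omega>) * (1 + \<omega> + \<omega>\<^sup>2) = 1 - \<omega> ^ 3" by algebra
  also have "\<omega> ^ 3 = 1" by (simp add: 1 Complex.DeMoivre)
  finally have "\<omega> = 1 \<or> 1 + \<omega> + \<omega>\<^sup>2 = 0" by simp
  moreover have "\<omega> \<noteq> 1"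
  proof
    assume "\<omega> = 1"
    hence "Re \<omega> = 1" by simp
    thus False by (simp add: 1 cos_120)
  qed
  ultimately show ?thesis by simp
qed

lemma vwp_square_root_factor:
  assumes "s\<^sup>2 = a" "norm a < 1" "norm p < 1"
  shows "qpoch (p * s) p k * qpoch (- (p * s)) p k / (qpoch s p k * qpoch (- s) p k)
           = (1 - a * p ^ (2 * k)) / (1 - a)"
proof -
  have p2: "norm (p\<^sup>2) < 1" using norm_power_less_one[OF assms(3), of 2] by simp
  have "(1 - a) * qpoch (p\<^sup>2 * a) (p\<^sup>2) k = qpoch a (p\<^sup>2) k * (1 - a * p ^ (2 * k))"
    using qpoch_Suc_shift[of a "p\<^sup>2" k] by (simp add: qpoch_Suc mult_ac power_mult [symmetric])
  moreover have "1 - a \<noteq> 0" "qpoch a (p\<^sup>2) k \<noteq> 0"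
    using assms(2) qpoch_nonzero[OF assms(2) p2] by auto
  ultimately show ?thesis
    unfolding qpoch_plus_minus power_mult_distrib assms(1) by (simp add: field_simps)
qed

theorem theorem9p1:
  fixes q h a x y z :: complex
    and \<alpha> sq sx sy sz :: complex \<comment> \<open>chosen roots of \<open>a\<close>, \<open>q\<close>, \<open>x\<close>, \<open>y\<close>, \<open>z\<close>\<close>
    and \<sigma> :: real
    and \<omega> r ux uy uz va vz \<kappa> :: complex
    and params :: "complex list"
    and num den :: "real \<Rightarrow> complex"
  defines "\<omega> \<equiv> exp (2 / 3 * of_real pi * \<i>)"
    and "r \<equiv> sx * sy * sz / (sq * \<alpha> ^ 3)"        \<comment> \<open>root of \<open>xyz/(qa)\<close>\<close>
    and "ux \<equiv> sq * \<alpha> ^ 3 * sx / (sy * sz)"        \<comment> \<open>root of \<open>qax/(yz)\<close>\<close>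
    and "uy \<equiv> sq * \<alpha> ^ 3 * sy / (sx * sz)"
    and "uz \<equiv> sq * \<alpha> ^ 3 * sz / (sx * sy)"
    and "va \<equiv> a * (sq / (sx * sy * sz))"
    and "vz \<equiv> q * a / (sx * sy * sz)"
    and "\<kappa> \<equiv> \<alpha> ^ 5 * (sq / (sx * sy * sz))"
    and "params \<equiv> [x, q * x, q\<^sup>2 * x, y, q * y, q\<^sup>2 * y, z, q * z, q\<^sup>2 * z]"
    and "num \<equiv> (\<lambda>\<psi>. let w = cis \<psi>; s = of_real \<sigma> in
            qpochs_inf
              (map (\<lambda>c. c * (s / w)) [h * r, q / h * (1 / r)]
               @ map (\<lambda>c. c * (w / s)) [h * r, q / h * (1 / r), va, - va, vz, - vz]) q)"
    and "den \<equiv> (\<lambda>\<psi>. let w = cis \<psi>; s = of_real \<sigma> in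
            qpochs_inf
              (map (\<lambda>c. c * (s / w)) [r, 1 / r]
               @ map (\<lambda>c. c * (w / s)) [ux, uy, uz, \<kappa>, \<omega> * \<kappa>, \<omega>\<^sup>2 * \<kappa>]) q)"
  assumes nonzero: "q \<noteq> 0" "h \<noteq> 0" "a \<noteq> 0" "x \<noteq> 0" "y \<noteq> 0" "z \<noteq> 0"
    and roots: "\<alpha> ^ 6 = a" "sq\<^sup>2 = q" "sx\<^sup>2 = x" "sy\<^sup>2 = y" "sz\<^sup>2 = z"
    and base: "norm q < 1"
    and conv: "norm (q ^ 3 * a ^ 4) < norm (x * y * z) ^ 3"
    and sigma: "0 < \<sigma>"
    and no_vanishing_prefactor:
      "qthetas [h, h * (x * y * z / (q * a))] q \<noteq> 0"
      "qpochs_inf [q * a / x, q * a / y, q * a / z, a] q \<noteq> 0"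
    and no_vanishing_integrand: "\<And>\<psi>. \<psi> \<in> {- pi..pi} \<Longrightarrow> den \<psi> \<noteq> 0"
    and no_vanishing_series:
      "\<And>k. qpochs (q ^ 3 # vwp_lower a (\<alpha> ^ 3) params (q ^ 3)) (q ^ 3) k \<noteq> 0"
    and modulus: "norm (of_real \<sigma> * r) < 1" "norm (of_real \<sigma> * (1 / r)) < 1"
      "norm ux / \<sigma> < 1" "norm uy / \<sigma> < 1" "norm uz / \<sigma> < 1" "norm \<kappa> / \<sigma> < 1"
  shows "vwp_series a (\<alpha> ^ 3) params (q ^ 3) (q ^ 3 * a ^ 4 / (x * y * z) ^ 3) =
    qpochs_inf [q, q * a, q * a / (x * y), q * a / (x * z), q * a / (y * z), x, y, z,
                \<alpha>\<^sup>2, \<omega> * \<alpha>\<^sup>2, \<omega>\<^sup>2 * \<alpha>\<^sup>2] q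
    / (2 * of_real pi * qthetas [h, h * (x * y * z / (q * a))] q
       * qpochs_inf [q * a / x, q * a / y, q * a / z, a] q)
    * integral {- pi..pi} (\<lambda>\<psi>. num \<psi> / den \<psi>)"
proof -
  \<comment> \<open>With \<open>cis \<psi> / \<sigma>\<close> as variable of integration the circle has radius \<open>1 / \<sigma>\<close>.\<close>
  define R where "R = 1 / \<sigma>"
  have R0: "R > 0" using sigma by (simp add: R_def)
  have rnz: "\<alpha> \<noteq> 0" "sq \<noteq> 0" "sx \<noteq> 0" "sy \<noteq> 0" "sz \<noteq> 0" using nonzero roots by auto
  have nz: "r \<noteq> 0" "ux \<noteq> 0" "uy \<noteq> 0" "uz \<noteq> 0" "\<kappa> \<noteq> 0"
    using rnz by (simp_all add: r_def ux_def uy_def uz_def \<kappa>_def)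
  note root_simps = roots [symmetric] r_def ux_def uy_def uz_def \<kappa>_def va_def vz_def
  have ids: "ux * r = x" "uy * r = y" "uz * r = z"
      "uy * uz = q * a / x" "ux * uz = q * a / y" "ux * uy = q * a / z"
      "uz / r = q * a / (x * y)" "uy / r = q * a / (x * z)" "ux / r = q * a / (y * z)"
      "q * a = ux * uy * uz * r" "x * y * z / (q * a) = r\<^sup>2"
      "\<kappa> * r = \<alpha>\<^sup>2" "\<kappa> ^ 3 = a / r ^ 3" "va\<^sup>2 = a / r\<^sup>2" "vz = sq * va"
      "q ^ 3 * a ^ 4 / (x * y * z) ^ 3 = a / r ^ 6"
    unfolding root_simps using rnz by (simp_all add: field_simps power2_eq_square eval_nat_numeral)
  have R_less: "norm r < R" "norm (1 / r) < R" "norm ux * R < 1" "norm uy * R < 1"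
      "norm uz * R < 1" "norm \<kappa> * R < 1"
    using modulus sigma by (simp_all add: R_def norm_mult norm_divide field_simps)
  \<comment> \<open>The condition on \<open>\<kappa>\<close> is the condition for the convergence of Rogers' series on the circle.\<close>
  have ar: "norm a * R ^ 3 < norm r ^ 3"
  proof -
    have "norm a = norm \<kappa> ^ 3 * norm r ^ 3"
      using ids(13) nz by (metis nonzero_eq_divide_eq norm_mult norm_power power_not_zero)
    hence "norm a * R ^ 3 = (norm \<kappa> * R) ^ 3 * norm r ^ 3" by (simp add: power_mult_distrib)
    moreover have "(norm \<kappa> * R) ^ 3 < 1" using R_less(6) R0 by (simp add: power_less_one_iff)
    ultimately show ?thesis using nz(1) by simp
  qed
  have a1: "norm a < 1"
  proof -
    have "norm r ^ 3 < R ^ 3" using R_less(1) by (intro power_strict_mono) auto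
    hence "norm a * R ^ 3 < 1 * R ^ 3" using ar by linarith
    thus ?thesis using R0 by simp
  qed
  have theta: "qtheta h q \<noteq> 0" "qtheta (h * r\<^sup>2) q \<noteq> 0"
    using no_vanishing_prefactor(1) unfolding ids(11) by (auto simp: qthetas_def)
  define p where "p = q ^ 3"
  have p: "norm p < 1" unfolding p_def by (rule norm_power_less_one[OF base]) simp
  have \<omega>: "1 + \<omega> + \<omega>\<^sup>2 = 0" unfolding \<omega>_def by (rule primitive_cube_root_sum)
  define F where "F = (\<lambda>w. qtheta (h * r / w) q * qtheta (h * r * w) q * qpoch_inf (a * w\<^sup>2 / r\<^sup>2) q /
        (qpoch_inf (r / w) q * qpoch_inf (1 / (r * w)) q *
         (qpoch_inf (ux * w) q * qpoch_inf (uy * w) q * qpoch_inf (uz * w) q) *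
         qpoch_inf (a * w ^ 3 / r ^ 3) (q ^ 3)))"
  have integrand: "num \<psi> / den \<psi> = F (of_real R * cis \<psi>)" for \<psi>
  proof -
    define w where "w = of_real R * cis \<psi>"
    have w: "cis \<psi> / of_real \<sigma> = w" "of_real \<sigma> / cis \<psi> = 1 / w"
      using sigma by (simp_all add: w_def R_def field_simps)
    have w0: "w \<noteq> 0" using R0 by (simp add: w_def)
    have va: "qpoch_inf (va * w) q * qpoch_inf (- (va * w)) q * qpoch_inf (vz * w) q
        * qpoch_inf (- (vz * w)) q
        = qpoch_inf (a * w\<^sup>2 / r\<^sup>2) q"
      using qpoch_inf_square[OF base roots(2), of "va * w"] ids(14)
      by (simp add: ids(15) power_mult_distrib mult_ac)
    have \<kappa>: "qpoch_inf (\<kappa> * w) q * qpoch_inf (\<omega> * \<kappa> * w) q * qpoch_inf (\<omega>\<^sup>2 * \<kappa> * w) q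
        = qpoch_inf (a * w ^ 3 / r ^ 3) (q ^ 3)"
      using qpoch_inf_cube[OF base \<omega>, of "\<kappa> * w"] ids(13)
      by (simp add: power_mult_distrib mult_ac)
    have n: "num \<psi> = qtheta (h * r / w) q * qtheta (h * r * w) q * qpoch_inf (a * w\<^sup>2 / r\<^sup>2) q"
      unfolding va [symmetric] num_def Let_def w
      by (simp add: qpochs_inf_def qtheta_def mult_ac)
    have d: "den \<psi> = qpoch_inf (r / w) q * qpoch_inf (1 / (r * w)) q *
         (qpoch_inf (ux * w) q * qpoch_inf (uy * w) q * qpoch_inf (uz * w) q) *
         qpoch_inf (a * w ^ 3 / r ^ 3) (q ^ 3)"
      unfolding \<kappa> [symmetric] den_def Let_def w
      by (simp add: qpochs_inf_def mult_ac)
    show ?thesis unfolding n d F_def w_def ..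
  qed
  have int: "integral {- pi..pi} (\<lambda>\<psi>. num \<psi> / den \<psi>) = circle_integral R F"
    unfolding integrand circle_integral_def ..
  have series_term: "qpochs (vwp_upper a (\<alpha> ^ 3) params (q ^ 3)) (q ^ 3) k /
      qpochs (q ^ 3 # vwp_lower a (\<alpha> ^ 3) params (q ^ 3)) (q ^ 3) k *
      (q ^ 3 * a ^ 4 / (x * y * z) ^ 3) ^ k
    = cubic_coeff a q k *
            (qpoch (ux * r) q (3 * k) * qpoch (uy * r) q (3 * k) * qpoch (uz * r) q (3 * k) /
             (qpoch (ux * uy) q (3 * k) * qpoch (ux * uz) q (3 * k) * qpoch (uy * uz) q (3 * k))) *
            (a / r ^ 6) ^ k" for k
  proof -
    have sqrt_factor: "qpoch (p * \<alpha> ^ 3) p k * qpoch (- (p * \<alpha> ^ 3)) p k / (qpoch (\<alpha> ^ 3) p k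
        * qpoch (- (\<alpha> ^ 3)) p k)
           = (1 - a * p ^ (2 * k)) / (1 - a)"
      by (rule vwp_square_root_factor[OF _ a1 p]) (simp add: roots(1) [symmetric] power_mult [symmetric])
    have upper: "qpochs (vwp_upper a (\<alpha> ^ 3) params (q ^ 3)) (q ^ 3) k = qpoch a p k *
        (qpoch (p * \<alpha> ^ 3) p k * qpoch (- (p * \<alpha> ^ 3)) p k) *
        (qpoch x q (3 * k) * qpoch y q (3 * k) * qpoch z q (3 * k))"
      unfolding qpoch_triple by (simp add: qpochs_def vwp_upper_def params_def p_def mult_ac)
    have quot: "p * a / t = q\<^sup>2 * (q * a / t)" "p * a / (q * t) = q * (q * a / t)"
        "p * a / (q\<^sup>2 * t) = q * a / t" for t
      using nonzero(1) by (simp_all add: p_def power2_eq_square power3_eq_cube)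
    have lower: "qpochs (q ^ 3 # vwp_lower a (\<alpha> ^ 3) params (q ^ 3)) (q ^ 3) k = qpoch p p k *
        (qpoch (\<alpha> ^ 3) p k * qpoch (- (\<alpha> ^ 3)) p k) *
        (qpoch (q * a / z) q (3 * k) * qpoch (q * a / y) q (3 * k) * qpoch (q * a / x) q (3 * k))"
      unfolding qpoch_triple p_def [symmetric]
      by (simp only: qpochs_def vwp_lower_def params_def append.simps list.map
          quot(1)[of x] quot(1)[of y] quot(1)[of z] quot(2,3) prod_list.Cons prod_list.Nil)
         (simp only: mult_ac mult_1_right mult_1_left)
    have "qpochs (vwp_upper a (\<alpha> ^ 3) params (q ^ 3)) (q ^ 3) k /
      qpochs (q ^ 3 # vwp_lower a (\<alpha> ^ 3) params (q ^ 3)) (q ^ 3) k =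
      (qpoch (p * \<alpha> ^ 3) p k * qpoch (- (p * \<alpha> ^ 3)) p k / (qpoch (\<alpha> ^ 3) p k * qpoch (- (\<alpha> ^ 3)) p k)) *
      (qpoch a p k / qpoch p p k) *
      (qpoch x q (3 * k) * qpoch y q (3 * k) * qpoch z q (3 * k) /
        (qpoch (q * a / z) q (3 * k) * qpoch (q * a / y) q (3 * k) * qpoch (q * a / x) q (3 * k)))"
      unfolding upper lower by (simp only: times_divide_times_eq mult_ac)
    also have "\<dots> = cubic_coeff a q k * (qpoch x q (3 * k) * qpoch y q (3 * k) * qpoch z q (3 * k) /
        (qpoch (q * a / z) q (3 * k) * qpoch (q * a / y) q (3 * k) * qpoch (q * a / x) q (3 * k)))"
      unfolding sqrt_factor unfolding cubic_coeff_def p_def by (simp add: power_mult [symmetric])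
    finally show ?thesis unfolding ids(1-6,16) by simp
  qed
  have "vwp_series a (\<alpha> ^ 3) params (q ^ 3) (q ^ 3 * a ^ 4 / (x * y * z) ^ 3) =
     qpoch_inf (ux * r) q * qpoch_inf (uy * r) q * qpoch_inf (uz * r) q * qpoch_inf q q *
      (qpoch_inf (ux / r) q * qpoch_inf (uy / r) q * qpoch_inf (uz / r) q) * qpoch_inf (q ^ 3
          * a) (q ^ 3) /
      (2 * of_real pi * (qtheta h q * qtheta (h * r\<^sup>2) q) *
        (qpoch_inf (ux * uy) q * qpoch_inf (ux * uz) q * qpoch_inf (uy * uz) q)) * circle_integral R F"
    unfolding vwp_series_def q_hypergeom_def series_term F_def
    by (rule sums_unique [symmetric], rule cubic_integral_representation)
       (fact nonzero base nz ids R_less ar theta)+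
  moreover have "qpochs_inf [q, q * a, q * a / (x * y), q * a / (x * z), q * a / (y * z), x, y, z,
                \<alpha>\<^sup>2, \<omega> * \<alpha>\<^sup>2, \<omega>\<^sup>2 * \<alpha>\<^sup>2] q
      / (2 * of_real pi * qthetas [h, h * (x * y * z / (q * a))] q
       * qpochs_inf [q * a / x, q * a / y, q * a / z, a] q)
    = qpoch_inf (ux * r) q * qpoch_inf (uy * r) q * qpoch_inf (uz * r) q * qpoch_inf q q *
      (qpoch_inf (ux / r) q * qpoch_inf (uy / r) q * qpoch_inf (uz / r) q) * qpoch_inf (q ^ 3
          * a) (q ^ 3) /
      (2 * of_real pi * (qtheta h q * qtheta (h * r\<^sup>2) q) *
        (qpoch_inf (ux * uy) q * qpoch_inf (ux * uz) q * qpoch_inf (uy * uz) q))"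
  proof -
    have "(\<alpha>\<^sup>2) ^ 3 = a" by (simp add: roots(1) [symmetric] power_mult [symmetric])
    hence "qpoch_inf (\<alpha>\<^sup>2) q * qpoch_inf (\<omega> * \<alpha>\<^sup>2) q * qpoch_inf (\<omega>\<^sup>2 * \<alpha>\<^sup>2) q = qpoch_inf a (q ^ 3)"
      using qpoch_inf_cube[OF base \<omega>, of "\<alpha>\<^sup>2"] by simp
    also have "\<dots> = (1 - a) * qpoch_inf (q ^ 3 * a) (q ^ 3)"
      using qpoch_inf_step[OF p, of a] by (simp add: p_def mult.commute)
    finally have cube: "qpoch_inf (\<alpha>\<^sup>2) q * qpoch_inf (\<omega> * \<alpha>\<^sup>2) q * qpoch_inf (\<omega>\<^sup>2 * \<alpha>\<^sup>2) q
        = (1 - a) * qpoch_inf (q ^ 3 * a) (q ^ 3)" .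
    have step: "qpoch_inf a q = (1 - a) * qpoch_inf (q * a) q"
      using qpoch_inf_step[OF base, of a] by (simp add: mult.commute)
    have anz: "1 - a \<noteq> 0" "qpoch_inf (q * a) q \<noteq> 0"
      using step qpoch_inf_nonzero[OF a1 base] by auto
    have alg: "Q * (Qa * (u1 * (u2 * (u3 * (x1 * (x2 * (x3 * K))))))) / (w * (t1 * t2) * (d1 * (d2
        * (d3 * (b * Qa)))))
        = x1 * x2 * x3 * Q * (u3 * u2 * u1) * P / (w * (t1 * t2) * (d3 * d2 * d1))"
      if "K = b * P" "b \<noteq> 0" "Qa \<noteq> 0" for Q Qa u1 u2 u3 x1 x2 x3 K w t1 t2 d1 d2 d3 b P :: complex
    proof -
      have "Q * (Qa * (u1 * (u2 * (u3 * (x1 * (x2 * (x3 * K))))))) / (w * (t1 * t2) * (d1 * (d2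
          * (d3 * (b * Qa)))))
         = (b * Qa) * (x1 * x2 * x3 * Q * (u3 * u2 * u1) * P) / ((b * Qa) * (w * (t1 * t2) * (d3
             * d2 * d1)))"
        unfolding that(1) by (simp only: mult_ac)
      thus ?thesis using that(2,3) by simp
    qed
    show ?thesis
      unfolding ids(1-9,11) qpochs_inf_def qthetas_def list.map prod_list.Cons prod_list.Nil mult_1_right step
      by (rule alg[OF _ anz]) (simp only: cube mult.assoc [symmetric])
  qed
  ultimately show ?thesis unfolding int by simp
qed

end
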